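(* Let $\boldsymbol{\mathfrak a}=(\mathfrak a_1,\dots,\mathfrak a_r)\subseteq(\mathcal O_{X,O})^r$ be a tuple of ideals and fix a point $\boldsymbol\lambda\in\mathbb R_{\geqslant0}^r$. Then, after a finite number of steps of the algorithm described in the context, run on a common log-resolution of $\boldsymbol{\mathfrak a}$, the set $D$ includes a representative of every constancy region in the compact set $(\boldsymbol\lambda_0+\mathbb R_{\geqslant0}^r)\cap(\boldsymbol\lambda-\mathbb R_{\geqslant0}^r)$, where $\boldsymbol\lambda_0=(0,\dots,0)$; that is, for every $\boldsymbol\mu$ in this compact set, $D$ contains a point of $\mathcal C_{\boldsymbol{\mathfrak a}}(\boldsymbol\mu)$.
   Context: Setup. $X$ is a normal complex surface and $O\in X$ is a point at which $X$ has at worst a rational singularity. One works locally at $O$. The $\mathfrak a_i$ are non-zero ideals of $\mathcal O_{X,O}$. Fix a common log-resolution $\pi:X'\to X$: birational, $X'$ smooth, $\mathfrak a_i\cdot\mathcal O_{X'}=\mathcal O_{X'}(-F_i)$ with $F_i$ effective Cartier, $\sum_iF_i+E$ with simple normal crossings, $E$ the exceptional locus (over $O$), a tree of smooth rational curves $E_1,\dots,E_s$. $K_\pi=\sum_{j=1}^sk_jE_j$ is the $\mathbb Q$-divisor with $(K_\pi+E_j)\cdot E_j=-2$ for $j=1,\dots,s$. Mixed multiplier ideal: $\mathcal J(\boldsymbol{\mathfrak a}^{\boldsymbol\lambda})=\pi_*\mathcal O_{X'}(\lceil K_\pi-\lambda_1F_1-\cdots-\lambda_rF_r\rceil)$ for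 $\boldsymbol\lambda\in\mathbb R^r_{\geqslant0}$. Region: $\mathcal R_{\boldsymbol{\mathfrak a}}(\boldsymbol\lambda)=\{\boldsymbol\lambda'\in\mathbb R_{\geqslant0}^r\mid\mathcal J(\boldsymbol{\mathfrak a}^{\boldsymbol\lambda'})\supseteq\mathcal J(\boldsymbol{\mathfrak a}^{\boldsymbol\lambda})\}$; it is a rational convex polytope, open in $\mathbb R_{\geqslant 0}^r$ (subspace topology). Constancy region: $\mathcal C_{\boldsymbol{\mathfrak a}}(\boldsymbol\lambda)=\{\boldsymbol\lambda'\in\mathbb R_{\geqslant0}^r\mid\mathcal J(\boldsymbol{\mathfrak a}^{\boldsymbol\lambda'})=\mathcal J(\boldsymbol{\mathfrak a}^{\boldsymbol\lambda})\}$. A representative of a constancy region is a point in it. The supporting hyperplanes of $\mathcal R_{\boldsymbol{\mathfrak a}}(\boldsymbol\lambda)$ are the hyperplanes spanned by the facets of its boundary (boundary taken in $\mathbb R_{\geqslant0}^r$). Algorithm. $N$ and $D$ are ordered lists of points. Initially $N=\{\boldsymbol\lambda_0\}$ with $\boldsymbol\lambda_0=(0,\dots,0)$, and $D=\emptyset$. For $j=0,1,2,\dots$ perform: $(j.1)$ Let $\boldsymbol\lambda_j$ be the first point of $N$ and compute $\mathcal R_{\boldsymbol{\mathfrak a}}(\boldsymbol\lambda_j)$. If some $\boldsymbol\lambda\in N$ satisfies $\boldsymbol\lambda\in\mathcal R_{\boldsymbol{\mathfrak a}}(\boldsymbol\lambda_j)$ and $\mathcal J(\boldsymbol{\mathfrak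 a}^{\boldsymbol\lambda})\neq\mathcal J(\boldsymbol{\mathfrak a}^{\boldsymbol\lambda_j})$, move $\boldsymbol\lambda$ to the first place of $N$ and repeat $(j.1)$; otherwise go to $(j.2)$ with this $\boldsymbol\lambda_j$. $(j.2)$ If some $\boldsymbol\lambda\in D$ satisfies $\mathcal J(\boldsymbol{\mathfrak a}^{\boldsymbol\lambda})=\mathcal J(\boldsymbol{\mathfrak a}^{\boldsymbol\lambda_j})$, go to $(j.4)$; otherwise go to $(j.3)$. $(j.3)$ Compute $\mathcal C(j)=\mathcal R_{\boldsymbol{\mathfrak a}}(\boldsymbol\lambda_j)\setminus\bigcup_{i<j}\mathcal R_{\boldsymbol{\mathfrak a}}(\boldsymbol\lambda_i)$, the union being over all points chosen at previous steps. For each connected component of $\mathcal C(j)$ compute its outer facets, i.e. the intersections of its boundary with the supporting hyperplanes $H$ of $\mathcal R_{\boldsymbol{\mathfrak a}}(\boldsymbol\lambda_j)$ (having non-empty interior as subspaces of $H$). Pick one interior point (with respect to $H$) in each outer facet of $\mathcal C(j)$ and add these points at the end of $N$. $(j.4)$ Delete $\boldsymbol\lambda_j$ from $N$ and add it at the end of $D$. *)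

theory Defs
  imports
    "HOL-Analysis.Analysis"
    "HOL-Computational_Algebra.Polynomial"
    "HOL-Library.Extended_Nat"
    "HOL-Algebra.Generated_Rings"
    "HOL-Algebra.Ring_Divisibility"
begin

section \<open>Surfaces and their modifications as models in the sense of Zariski\<close>

text \<open>
  All schemes below are integral, separated and birational to one another.  Such a scheme is
  determined by its function field, a type \<open>'k\<close> of class \<open>field\<close>, and the set of local rings of its
  points, which are subrings of \<open>'k\<close> (Zariski--Samuel, Commutative Algebra II, Ch. VI, Sect. 17).
  A scheme is therefore a set of subrings, a point is identified with its local ring, and a point
  \<open>x\<close> lies in the closure of the point \<open>y\<close> iff \<open>x \<subseteq> y\<close>.
  Subrings of \<open>'k\<close> are made available to HOL-Algebra through \<open>ring_on\<close>.
\<close>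

definition ring_on :: "'k::field set \<Rightarrow> 'k ring" where
  "ring_on A = \<lparr>carrier = A, monoid.mult = (*), one = 1, ring.zero = 0, add = (+)\<rparr>"

definition local_ring :: "'k::field set \<Rightarrow> bool" where
  "local_ring A \<longleftrightarrow> subring A (ring_on UNIV) \<and> (\<exists>!M. maximalideal M (ring_on A))"

definition max_ideal :: "'k::field set \<Rightarrow> 'k set" where
  "max_ideal A = (THE M. maximalideal M (ring_on A))"

definition localization :: "'k::field set \<Rightarrow> 'k set \<Rightarrow> 'k set" where
  "localization A P = {f / s |f s. f \<in> A \<and> s \<in> A \<and> s \<notin> P}"

definition krull_dim :: "'k::field set \<Rightarrow> enat" where
  "krull_dim A = Sup {enat n |n. \<exists>P :: nat \<Rightarrow> 'k set.
     (\<forall>i\<le>n. primeideal (P i) (ring_on A)) \<and> (\<forall>i<n. P i \<subset> P (Suc i))}"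

definition regular_local_ring :: "'k::field set \<Rightarrow> bool" where
  "regular_local_ring A \<longleftrightarrow> local_ring A \<and> noetherian_ring (ring_on A) \<and>
     (\<exists>S. finite S \<and> enat (card S) = krull_dim A \<and> max_ideal A = genideal (ring_on A) S)"

definition integrally_closed :: "'k::field set \<Rightarrow> bool" where
  "integrally_closed A \<longleftrightarrow>
     (\<forall>f n c. (\<forall>i<n. c i \<in> A) \<and> f ^ n + (\<Sum>i<n. c i * f ^ i) = 0 \<longrightarrow> f \<in> A)"

definition fg_algebra :: "'k::field set \<Rightarrow> 'k set \<Rightarrow> bool" where
  "fg_algebra R A \<longleftrightarrow> (\<exists>S. finite S \<and> A = generate_ring (ring_on UNIV) (R \<union> S))"

definition spectrum :: "'k::field set \<Rightarrow> 'k set set" where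
  "spectrum A = {localization A P |P. primeideal P (ring_on A)}"

text \<open>
  \<open>R\<close> is the local ring \<open>\<O>\<^bsub>X,O\<^esub>\<close> of a normal complex algebraic surface at a closed point, \<open>'k\<close> being
  the function field of the surface; \<open>\<iota>\<close> is its structure of a complex algebra.
\<close>

definition normal_surface_point :: "(complex \<Rightarrow> 'k::field) \<Rightarrow> 'k set \<Rightarrow> bool" where
  "normal_surface_point \<iota> R \<longleftrightarrow>
     \<iota> \<in> ring_hom (ring_on UNIV) (ring_on UNIV) \<and>
     (\<exists>A M. fg_algebra (range \<iota>) A \<and> maximalideal M (ring_on A) \<and> R = localization A M) \<and>
     (\<forall>f. \<exists>g\<in>R. \<exists>h\<in>R. h \<noteq> 0 \<and> f = g / h) \<and>
     krull_dim R = 2 \<and> integrally_closed R"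

definition valuation_ring :: "'k::field set \<Rightarrow> bool" where
  "valuation_ring V \<longleftrightarrow> subring V (ring_on UNIV) \<and> (\<forall>f. f \<in> V \<or> inverse f \<in> V)"

definition dominates :: "'k::field set \<Rightarrow> 'k set \<Rightarrow> bool" where
  "dominates V A \<longleftrightarrow> A \<subseteq> V \<and> max_ideal A \<subseteq> max_ideal V"

definition affine_cover :: "'k::field set \<Rightarrow> 'k set set \<Rightarrow> 'k set set \<Rightarrow> bool" where
  "affine_cover R X \<A> \<longleftrightarrow> finite \<A> \<and> (\<forall>A\<in>\<A>. fg_algebra R A) \<and> X = (\<Union>A\<in>\<A>. spectrum A)"

text \<open>
  Integral schemes proper and birational over \<open>Spec R\<close>: the uniqueness and the existence in the last
  clause are the valuative criteria of separatedness and properness.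
\<close>

definition proper_birational_model :: "'k::field set \<Rightarrow> 'k set set \<Rightarrow> bool" where
  "proper_birational_model R X \<longleftrightarrow> (\<exists>\<A>. affine_cover R X \<A>) \<and>
     (\<forall>V. valuation_ring V \<and> R \<subseteq> V \<longrightarrow> (\<exists>!x. x \<in> X \<and> dominates V x))"

text \<open>Over the complex numbers, smooth and regular are the same.\<close>

definition resolution :: "'k::field set \<Rightarrow> 'k set set \<Rightarrow> bool" where
  "resolution R X \<longleftrightarrow> proper_birational_model R X \<and> (\<forall>x\<in>X. regular_local_ring x)"

text \<open>
  Vanishing of \<open>H\<^sup>1(X, \<O>\<^sub>X)\<close>, the first cohomology being computed by Cech cocycles of an affine cover.
  The sections of the structure sheaf over an open set are the intersection of the local rings of
  its points; the ring of sections over \<open>spectrum A\<close> is \<open>A\<close>.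
\<close>

definition H1_structure_sheaf_zero :: "'k::field set \<Rightarrow> 'k set set \<Rightarrow> bool" where
  "H1_structure_sheaf_zero R X \<longleftrightarrow>
     (\<forall>\<A> c. affine_cover R X \<A> \<and>
        (\<forall>A\<in>\<A>. \<forall>B\<in>\<A>. c A B \<in> \<Inter>(spectrum A \<inter> spectrum B)) \<and>
        (\<forall>A\<in>\<A>. \<forall>B\<in>\<A>. \<forall>C\<in>\<A>. c A B + c B C = c A C) \<longrightarrow>
        (\<exists>b. (\<forall>A\<in>\<A>. b A \<in> A) \<and> (\<forall>A\<in>\<A>. \<forall>B\<in>\<A>. c A B = b B - b A)))"

text \<open>
  Some desingularization \<open>\<pi>\<close> has vanishing \<open>R\<^sup>1\<pi>\<^sub>*\<O>\<close>, a module over \<open>R\<close> given by \<open>H\<^sup>1\<close> as \<open>Spec R\<close> is affine.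
  Regular points are included.
\<close>

definition rational_singularity :: "'k::field set \<Rightarrow> bool" where
  "rational_singularity R \<longleftrightarrow> (\<exists>X. resolution R X \<and> H1_structure_sheaf_zero R X)"


section \<open>Divisors and intersection numbers\<close>

text \<open>
  A prime divisor is identified with its generic point, hence with a discrete valuation ring \<open>C\<close>,
  and a divisor with the function assigning to each prime divisor its coefficient.
  The closed points of a model over a two-dimensional \<open>R\<close> are those with two-dimensional local ring.
\<close>

definition prime_divisors :: "'k::field set set \<Rightarrow> 'k set set" where
  "prime_divisors X = {C \<in> X. krull_dim C = 1}"

definition closed_points :: "'k::field set set \<Rightarrow> 'k set set" where
  "closed_points X = {x \<in> X. krull_dim x = 2}"

definition exceptional_divisors :: "'k::field set \<Rightarrow> 'k set set \<Rightarrow> 'k set set" where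
  "exceptional_divisors R X = {C \<in> prime_divisors X. dominates C R}"

text \<open>The valuation of a discrete valuation ring \<open>C\<close>; only meaningful at non-zero arguments.\<close>

definition ord_along :: "'k::field set \<Rightarrow> 'k \<Rightarrow> int" where
  "ord_along C f = (THE n. \<exists>t u. max_ideal C = genideal (ring_on C) {t} \<and>
     u \<in> C \<and> inverse u \<in> C \<and> u \<noteq> 0 \<and> f = t powi n * u)"

definition is_divisor :: "'k::field set set \<Rightarrow> ('k set \<Rightarrow> int) \<Rightarrow> bool" where
  "is_divisor X D \<longleftrightarrow> finite {C. D C \<noteq> 0} \<and> {C. D C \<noteq> 0} \<subseteq> prime_divisors X"

text \<open>Global sections and stalks of the sheaf \<open>\<O>\<^sub>X(D)\<close>, as subsets of the function field.\<close>

definition sections_of :: "'k::field set set \<Rightarrow> ('k set \<Rightarrow> int) \<Rightarrow> 'k set" where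
  "sections_of X D = {f. f = 0 \<or> (\<forall>C\<in>prime_divisors X. ord_along C f + D C \<ge> 0)}"

definition stalk_of :: "'k::field set set \<Rightarrow> ('k set \<Rightarrow> int) \<Rightarrow> 'k set \<Rightarrow> 'k set" where
  "stalk_of X D x = {f. f = 0 \<or> (\<forall>C\<in>prime_divisors X. x \<subseteq> C \<longrightarrow> ord_along C f + D C \<ge> 0)}"

text \<open>The ideal of the curve \<open>C\<close> in the local ring of its point \<open>x\<close>.\<close>

definition curve_ideal :: "'k::field set \<Rightarrow> 'k set \<Rightarrow> 'k set" where
  "curve_ideal C x = max_ideal C \<inter> x"

definition snc_divisor :: "'k::field set set \<Rightarrow> ('k set \<Rightarrow> int) \<Rightarrow> bool" where
  "snc_divisor X D \<longleftrightarrow> is_divisor X D \<and>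
     (\<forall>x\<in>closed_points X. \<exists>s t. max_ideal x = genideal (ring_on x) {s, t} \<and>
        (\<forall>C. D C \<noteq> 0 \<and> x \<subseteq> C \<longrightarrow>
           curve_ideal C x = genideal (ring_on x) {s} \<or> curve_ideal C x = genideal (ring_on x) {t}))"

text \<open>The length of the \<open>A\<close>-module \<open>A/I\<close>.\<close>

definition colength :: "'k::field set \<Rightarrow> 'k set \<Rightarrow> nat" where
  "colength A I = Sup {n. \<exists>J :: nat \<Rightarrow> 'k set.
     (\<forall>i\<le>n. ideal (J i) (ring_on A)) \<and> J 0 = I \<and> J n = A \<and> (\<forall>i<n. J i \<subset> J (Suc i))}"

definition proper_intersection_number :: "'k::field set set \<Rightarrow> 'k set \<Rightarrow> 'k set \<Rightarrow> int" where
  "proper_intersection_number X C E =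
     (\<Sum>x\<in>{x \<in> closed_points X. x \<subseteq> C \<and> x \<subseteq> E}.
        int (colength x (genideal (ring_on x) (curve_ideal C x \<union> curve_ideal E x))))"

text \<open>
  Self-intersection numbers are computed by moving \<open>E\<close> in its linear equivalence class: if \<open>f\<close> has
  order one along \<open>E\<close>, then \<open>E \<sim> E - div f\<close>, and \<open>E\<close> is not a component of \<open>E - div f\<close>.
  For complete \<open>E\<close> (i.e. \<open>E\<close> exceptional) the result does not depend on \<open>f\<close>.
\<close>

definition self_intersection_number :: "'k::field set set \<Rightarrow> 'k set \<Rightarrow> int" where
  "self_intersection_number X E =
     (let f = SOME f. f \<noteq> 0 \<and> ord_along E f = 1 in
      - (\<Sum>C\<in>{C \<in> prime_divisors X. C \<noteq> E \<and> ord_along C f \<noteq> 0}.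
           ord_along C f * proper_intersection_number X C E))"

definition intersection_number :: "'k::field set set \<Rightarrow> 'k set \<Rightarrow> 'k set \<Rightarrow> int" where
  "intersection_number X C E =
     (if C = E then self_intersection_number X E else proper_intersection_number X C E)"

definition relative_canonical_divisor ::
  "'k::field set \<Rightarrow> 'k set set \<Rightarrow> ('k set \<Rightarrow> rat) \<Rightarrow> bool" where
  "relative_canonical_divisor R X K \<longleftrightarrow>
     (\<forall>C. C \<notin> exceptional_divisors R X \<longrightarrow> K C = 0) \<and>
     (\<forall>E\<in>exceptional_divisors R X.
        (\<Sum>C\<in>exceptional_divisors R X. K C * of_int (intersection_number X C E))
          + of_int (intersection_number X E E) = -2)"

text \<open>The residue field of the generic point of the curve \<open>E\<close> is a simple extension \<open>\<complex>(t)\<close>.\<close>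

definition rational_curve :: "(complex \<Rightarrow> 'k::field) \<Rightarrow> 'k set \<Rightarrow> bool" where
  "rational_curve \<iota> E \<longleftrightarrow> (\<exists>t\<in>E. \<forall>f\<in>E. \<exists>p q :: complex poly.
     poly (map_poly \<iota> q) t \<notin> max_ideal E \<and>
     poly (map_poly \<iota> q) t * f - poly (map_poly \<iota> p) t \<in> max_ideal E)"

text \<open>
  The dual graph, with one edge for each point lying on two of the curves, is a tree (empty if there
  are no curves): it is connected and has one edge less than vertices.
\<close>

definition tree_of_curves :: "'k::field set set \<Rightarrow> 'k set set \<Rightarrow> bool" where
  "tree_of_curves X \<E> \<longleftrightarrow> finite \<E> \<and>
     (\<forall>C\<in>\<E>. \<forall>E\<in>\<E>.
        (C, E) \<in> {(C', E'). C' \<in> \<E> \<and> E' \<in> \<E> \<and> (\<exists>x\<in>closed_points X. x \<subseteq> C' \<and> x \<subseteq> E')}\<^sup>*) \<and>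
     (\<E> \<noteq> {} \<longrightarrow>
        Suc (card {x \<in> closed_points X. \<exists>C\<in>\<E>. \<exists>E\<in>\<E>. C \<noteq> E \<and> x \<subseteq> C \<and> x \<subseteq> E}) = card \<E>)"

text \<open>Smoothness of the exceptional curves is part of the simple normal crossings condition.\<close>

definition log_resolution ::
  "(complex \<Rightarrow> 'k::field) \<Rightarrow> 'k set \<Rightarrow> ('r::finite \<Rightarrow> 'k set) \<Rightarrow> 'k set set
     \<Rightarrow> ('r \<Rightarrow> 'k set \<Rightarrow> int) \<Rightarrow> bool" where
  "log_resolution \<iota> R \<aa> X F \<longleftrightarrow> resolution R X \<and>
     (\<forall>i. is_divisor X (F i) \<and> (\<forall>C. F i C \<ge> 0) \<and>
        (\<forall>x\<in>X. genideal (ring_on x) (\<aa> i) = stalk_of X (\<lambda>C. - F i C) x)) \<and>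
     snc_divisor X (\<lambda>C. (\<Sum>i\<in>UNIV. F i C) + of_bool (C \<in> exceptional_divisors R X)) \<and>
     tree_of_curves X (exceptional_divisors R X) \<and>
     (\<forall>E\<in>exceptional_divisors R X. rational_curve \<iota> E)"

text \<open>
  As \<open>Spec R\<close> is affine, the direct image sheaf is given by its module of global sections.
\<close>

definition mixed_multiplier_ideal ::
  "'k::field set set \<Rightarrow> ('k set \<Rightarrow> rat) \<Rightarrow> ('r::finite \<Rightarrow> 'k set \<Rightarrow> int) \<Rightarrow> real ^ 'r \<Rightarrow> 'k set" where
  "mixed_multiplier_ideal X K F \<xi> =
     sections_of X (\<lambda>C. \<lceil>of_rat (K C) - (\<Sum>i\<in>UNIV. \<xi> $ i * of_int (F i C))\<rceil>)"


section \<open>Regions, constancy regions and the algorithm\<close>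

text \<open>
  Below, \<open>J\<close> stands for the map sending a point of the orthant to its mixed multiplier ideal.
\<close>

definition orthant :: "(real ^ 'r::finite) set" where
  "orthant = {\<xi>. \<forall>i. 0 \<le> \<xi> $ i}"

definition region :: "(real ^ 'r::finite \<Rightarrow> 'a set) \<Rightarrow> real ^ 'r \<Rightarrow> (real ^ 'r) set" where
  "region J \<xi> = {\<xi>' \<in> orthant. J \<xi>' \<supseteq> J \<xi>}"

definition constancy_region :: "(real ^ 'r::finite \<Rightarrow> 'a set) \<Rightarrow> real ^ 'r \<Rightarrow> (real ^ 'r) set" where
  "constancy_region J \<xi> = {\<xi>' \<in> orthant. J \<xi>' = J \<xi>}"

text \<open>
  Boundaries are taken in the orthant, so that the facets of the polytope lying on coordinate
  hyperplanes do not contribute.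
\<close>

definition supporting_hyperplanes ::
  "(real ^ 'r::finite \<Rightarrow> 'a set) \<Rightarrow> real ^ 'r \<Rightarrow> (real ^ 'r) set set" where
  "supporting_hyperplanes J \<xi> =
     {affine hull \<Phi> |\<Phi>. \<Phi> facet_of closure (region J \<xi>) \<and>
                      \<Phi> \<subseteq> top_of_set orthant frontier_of region J \<xi>}"

text \<open>
  In the following, \<open>D\<close> lists the points chosen before \<open>\<xi>\<close>.  An outer facet is paired
  with the supporting hyperplane on which it lies.
\<close>

definition new_region ::
  "(real ^ 'r::finite \<Rightarrow> 'a set) \<Rightarrow> (real ^ 'r) list \<Rightarrow> real ^ 'r \<Rightarrow> (real ^ 'r) set" where
  "new_region J D \<xi> = region J \<xi> - (\<Union>\<delta>\<in>set D. region J \<delta>)"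

definition outer_facets ::
  "(real ^ 'r::finite \<Rightarrow> 'a set) \<Rightarrow> (real ^ 'r) list \<Rightarrow> real ^ 'r
     \<Rightarrow> ((real ^ 'r) set \<times> (real ^ 'r) set) set" where
  "outer_facets J D \<xi> =
     {(H, \<Phi>). H \<in> supporting_hyperplanes J \<xi> \<and> top_of_set H interior_of \<Phi> \<noteq> {} \<and>
        (\<exists>Q\<in>components (new_region J D \<xi>). \<Phi> = (top_of_set orthant frontier_of Q) \<inter> H)}"

text \<open>
  A state consists of the list \<open>N\<close> of points waiting to be processed and the list \<open>D\<close> of points done.
  Every point chosen for processing ends up in \<open>D\<close>, so \<open>D\<close> also records the points chosen at all
  previous steps.  The first point of \<open>N\<close> is chosen once no reordering is possible; if its ideal has
  been met before, it is moved to \<open>D\<close>, otherwise one interior point of each outer facet is in addition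
  appended to \<open>N\<close>, in any order.  Every single reordering counts as a step.
\<close>

type_synonym 'r algorithm_state = "(real ^ 'r) list \<times> (real ^ 'r) list"

definition reorderable ::
  "(real ^ 'r::finite \<Rightarrow> 'a set) \<Rightarrow> (real ^ 'r) list \<Rightarrow> real ^ 'r \<Rightarrow> bool" where
  "reorderable J N \<nu> \<longleftrightarrow> \<nu> \<in> set N \<and> \<nu> \<in> region J (hd N) \<and> J \<nu> \<noteq> J (hd N)"

inductive algorithm_step ::
  "(real ^ 'r::finite \<Rightarrow> 'a set) \<Rightarrow> 'r algorithm_state \<Rightarrow> 'r algorithm_state \<Rightarrow> bool"
  for J where
  reorder:
    "reorderable J N \<nu> \<Longrightarrow> algorithm_step J (N, D) (\<nu> # remove1 \<nu> N, D)"
| known_ideal: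
    "(\<nexists>\<nu>. reorderable J (\<xi> # N) \<nu>) \<Longrightarrow> \<exists>\<delta>\<in>set D. J \<delta> = J \<xi> \<Longrightarrow>
     algorithm_step J (\<xi> # N, D) (N, D @ [\<xi>])"
| new_ideal:
    "(\<nexists>\<nu>. reorderable J (\<xi> # N) \<nu>) \<Longrightarrow> \<not> (\<exists>\<delta>\<in>set D. J \<delta> = J \<xi>) \<Longrightarrow>
     distinct facets \<Longrightarrow> set facets = outer_facets J D \<xi> \<Longrightarrow>
     list_all2 (\<lambda>(H, \<Phi>) p. p \<in> top_of_set H interior_of \<Phi>) facets picked \<Longrightarrow>
     algorithm_step J (\<xi> # N, D) (N @ picked, D @ [\<xi>])"

text \<open>
  A run makes arbitrary admissible choices.  It stays in its last state if no further step is
  possible, so that every maximal sequence of steps is a run, whether or not it is infinite.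
\<close>

definition algorithm_run ::
  "(real ^ 'r::finite \<Rightarrow> 'a set) \<Rightarrow> (nat \<Rightarrow> 'r algorithm_state) \<Rightarrow> bool" where
  "algorithm_run J \<sigma> \<longleftrightarrow> \<sigma> 0 = ([0], []) \<and>
     (\<forall>n. algorithm_step J (\<sigma> n) (\<sigma> (Suc n)) \<or>
          (\<nexists>s. algorithm_step J (\<sigma> n) s) \<and> \<sigma> (Suc n) = \<sigma> n)"

end

theory Submission
  imports Defs
begin

text \<open>
  Every region is cut out of the orthant by finitely many half-spaces \<open>l C \<bullet> x < c\<close> with fixed normals
  \<open>l C \<ge> 0\<close>; this uses that no multiplier ideal is zero, so that each order attains a minimum on it.

  As the algorithm chooses points with maximal ideal, the new part \<open>\<C>(j)\<close> of a region consists of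
  points with the same ideal as the chosen one.  The interior points of an outer facet then all have
  the same ideal: a half-space separating two of them would have to cut the facet, but the regions
  of these points contain \<open>\<R>(\<lambda>\<^sub>j)\<close>.  Hence it does not matter which of them is picked.  If \<open>q\<close> is not covered yet, a
  generic ray towards a point just above \<open>q\<close> leaves the covered part in the interior of an outer
  facet, so the point picked there still waits in \<open>N\<close>, and its ideal contains that of \<open>q\<close>.  Every
  waiting point is processed eventually, because only finitely many ideals contain a given one, and
  only finitely many ideals occur near a compact box.
\<close>

section \<open>Polyhedral regions in the orthant\<close>

lemma in_orthant_inner_nonneg:
  assumes "a \<in> orthant" "x \<in> orthant"
  shows "0 \<le> a \<bullet> x"
  using assms by (auto simp: orthant_def inner_vec_def intro!: sum_nonneg)

lemma orthant_inner_mono: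
  assumes "a \<in> orthant" "y - x \<in> orthant"
  shows "a \<bullet> x \<le> a \<bullet> y"
  using in_orthant_inner_nonneg[OF assms] by (simp add: inner_diff_right)

lemma orthant_eq_Inter_halfspaces: "orthant = (\<Inter>i\<in>UNIV. {x. axis i 1 \<bullet> x \<ge> 0})"
  by (auto simp: orthant_def inner_axis' )

lemma polyhedron_orthant: "polyhedron orthant"
  unfolding orthant_eq_Inter_halfspaces
  by (rule polyhedron_Inter) (auto simp: polyhedron_halfspace_ge)

lemma closed_orthant: "closed orthant"
  by (simp add: polyhedron_imp_closed polyhedron_orthant)

lemma convex_orthant: "convex orthant"
  by (simp add: polyhedron_imp_convex polyhedron_orthant)

lemma zero_in_orthant: "0 \<in> orthant"
  by (simp add: orthant_def)

lemma orthant_add: "x \<in> orthant \<Longrightarrow> y \<in> orthant \<Longrightarrow> x + y \<in> orthant"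
  by (simp add: orthant_def)

lemma orthant_scaleR: "x \<in> orthant \<Longrightarrow> 0 \<le> t \<Longrightarrow> t *\<^sub>R x \<in> orthant"
  by (simp add: orthant_def)

lemma self_in_region: "\<xi> \<in> orthant \<Longrightarrow> \<xi> \<in> region J \<xi>"
  by (simp add: region_def)

lemma in_region_iff: "\<eta> \<in> region J \<xi> \<longleftrightarrow> \<eta> \<in> orthant \<and> J \<xi> \<subseteq> J \<eta>"
  by (simp add: region_def)

lemma outer_facet_subset_orthant:
  assumes "(H, \<Phi>) \<in> outer_facets J D \<xi>"
  shows "\<Phi> \<subseteq> orthant"
  using assms frontier_of_subset_topspace[of "top_of_set orthant"]
  by (auto simp: outer_facets_def)

lemma outer_facets_eq_empty:
  assumes "new_region J D \<xi> = {}"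
  shows "outer_facets J D \<xi> = {}"
  using assms by (simp add: outer_facets_def)

section \<open>Hyperplanes and connected components in Euclidean space\<close>

lemma ex_nonorthogonal_in_open:
  fixes V :: "'a::euclidean_space set"
  assumes "finite A" "0 \<notin> A" "open V" "V \<noteq> {}"
  shows "\<exists>x\<in>V. \<forall>a\<in>A. a \<bullet> x \<noteq> 0"
  using assms
proof (induction A arbitrary: V rule: finite_induct)
  case empty
  then show ?case by auto
next
  case (insert a A)
  have "closed {x. a \<bullet> x = 0}" by (rule closed_hyperplane)
  then have "open (V - {x. a \<bullet> x = 0})" using insert.prems by blast
  \<comment> \<open>A hyperplane has empty interior, so deleting it from a nonempty open set leaves
    a nonempty open set for the induction hypothesis.\<close>
  moreover have "\<not> V \<subseteq> {x. a \<bullet> x = 0}"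
    using insert.prems interior_hyperplane[of a 0] interior_maximal[of V "{x. a \<bullet> x = 0}"] by auto
  ultimately obtain x where "x \<in> V - {x. a \<bullet> x = 0}" "\<forall>a\<in>A. a \<bullet> x \<noteq> 0"
    using insert.IH[of "V - {x. a \<bullet> x = 0}"] insert.prems by blast
  then show ?case by auto
qed

text \<open>Moving from \<open>y\<close> by the same small amount along \<open>w - y\<close> and
  against it gives opposite inequalities for the linear form.\<close>

lemma linear_constant_on_hyperplane:
  fixes a l :: "'a::real_inner"
  assumes y: "a \<bullet> y = k" and e: "0 < e"
    and bound: "\<And>x. x \<in> ball y e \<Longrightarrow> a \<bullet> x = k \<Longrightarrow> l \<bullet> x \<le> l \<bullet> y"
    and w: "a \<bullet> w = k"
  shows "l \<bullet> w = l \<bullet> y"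
proof -
  define s where "s = e / (2 * (1 + norm (w - y)))"
  have pos: "0 < 1 + norm (w - y)" by (simp add: add_pos_nonneg)
  have s: "0 < s" using e pos by (simp add: s_def)
  have "s * norm (w - y) < e"
    using e pos by (simp add: s_def field_simps) (smt (verit) mult_nonneg_nonneg norm_ge_zero)
  then have in_ball: "y + s *\<^sub>R (w - y) \<in> ball y e" "y - s *\<^sub>R (w - y) \<in> ball y e"
    using s by (auto simp: dist_norm)
  have "l \<bullet> (y + s *\<^sub>R (w - y)) \<le> l \<bullet> y" "l \<bullet> (y - s *\<^sub>R (w - y)) \<le> l \<bullet> y"
    by (rule bound[OF in_ball(1)], use y w in \<open>simp add: inner_add_right inner_diff_right\<close>)
      (rule bound[OF in_ball(2)], use y w in \<open>simp add: inner_add_right inner_diff_right\<close>)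
  then have "s * (l \<bullet> (w - y)) = 0"
    by (simp add: inner_add_right inner_diff_right)
  then show ?thesis using s by (simp add: inner_diff_right)
qed

text \<open>Each component contains some member of the family and is recovered from one chosen point
  of it, so there are at most as many components as members.\<close>

lemma finite_components_Union_connected:
  assumes "finite \<F>" "\<And>F. F \<in> \<F> \<Longrightarrow> connected F"
  shows "finite (components (\<Union>\<F>))"
proof -
  have "components (\<Union>\<F>) \<subseteq> (\<lambda>F. connected_component_set (\<Union>\<F>) (SOME x. x \<in> F)) ` \<F>"
  proof
    fix Q assume "Q \<in> components (\<Union>\<F>)"
    then obtain x where x: "x \<in> \<Union>\<F>" and Q: "Q = connected_component_set (\<Union>\<F>) x"
      by (auto simp: components_def)
    then obtain F where F: "F \<in> \<F>" "x \<in> F" by auto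
    then have "(SOME x. x \<in> F) \<in> F" by (auto intro: someI)
    then have "(SOME x. x \<in> F) \<in> Q"
      using F assms(2)[OF F(1)] unfolding Q by (auto simp: connected_component_def)
    then have "Q = connected_component_set (\<Union>\<F>) (SOME x. x \<in> F)"
      unfolding Q by (simp add: connected_component_eq)
    then show "Q \<in> (\<lambda>F. connected_component_set (\<Union>\<F>) (SOME x. x \<in> F)) ` \<F>"
      using F by blast
  qed
  then show ?thesis using assms(1) finite_surj by blast
qed

text \<open>The abstract setting for the analysis of the algorithm. The normals \<open>l C\<close>
  do not depend on \<open>\<xi>\<close>, only the thresholds \<open>c \<xi> C\<close> do;
  nonnegativity of the normals makes regions downward closed in the orthant.\<close>

locale open_regions =
  fixes J :: "real ^ 'r::finite \<Rightarrow> 'a set" and S :: "'c set"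
    and l :: "'c \<Rightarrow> real ^ 'r" and c :: "real ^ 'r \<Rightarrow> 'c \<Rightarrow> real"
  assumes finite_S: "finite S"
    and l_orthant: "C \<in> S \<Longrightarrow> l C \<in> orthant"
    and l_nonzero: "C \<in> S \<Longrightarrow> l C \<noteq> 0"
    and region_eq: "\<xi> \<in> orthant \<Longrightarrow> region J \<xi> = {x \<in> orthant. \<forall>C\<in>S. l C \<bullet> x < c \<xi> C}"
    and finite_values: "\<xi> \<in> orthant \<Longrightarrow> finite (J ` region J \<xi>)"
begin

text \<open>The point \<open>\<xi>\<close> lies in its own region and
  \<open>l C \<bullet> \<xi>\<close> is nonnegative. Hence the origin is strictly inside every
  half-space.\<close>

lemma c_pos:
  assumes "\<xi> \<in> orthant" "C \<in> S"
  shows "0 < c \<xi> C"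
  using self_in_region[OF assms(1), of J] assms in_orthant_inner_nonneg[OF l_orthant assms(1)]
  by (fastforce simp: region_eq)

lemma region_down:
  assumes "\<xi> \<in> orthant" "y \<in> region J \<xi>" "x \<in> orthant" "y - x \<in> orthant"
  shows "x \<in> region J \<xi>"
  using assms orthant_inner_mono[OF l_orthant assms(4)] by (fastforce simp: region_eq)

lemma region_open:
  assumes "\<xi> \<in> orthant"
  obtains V where "open V" "region J \<xi> = orthant \<inter> V"
proof
  show "open (\<Inter>C\<in>S. {x. l C \<bullet> x < c \<xi> C})"
    using finite_S by (auto intro: open_halfspace_lt)
  show "region J \<xi> = orthant \<inter> (\<Inter>C\<in>S. {x. l C \<bullet> x < c \<xi> C})"
    using assms by (auto simp: region_eq)
qed

text \<open>Shrinking a point towards the origin turns weak inequalities into strict ones, because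
  all thresholds are positive.\<close>

lemma closure_region:
  assumes "\<xi> \<in> orthant"
  shows "closure (region J \<xi>) = {x \<in> orthant. \<forall>C\<in>S. l C \<bullet> x \<le> c \<xi> C}" (is "_ = ?K")
proof
  have "?K = orthant \<inter> (\<Inter>C\<in>S. {x. l C \<bullet> x \<le> c \<xi> C})" by auto
  then have "closed ?K"
    using closed_orthant by (auto intro!: closed_INT closed_halfspace_le)
  moreover have "region J \<xi> \<subseteq> ?K" using assms by (auto simp: region_eq less_imp_le)
  ultimately show "closure (region J \<xi>) \<subseteq> ?K" by (rule closure_minimal[rotated])
next
  show "?K \<subseteq> closure (region J \<xi>)"
  proof
    fix x assume x: "x \<in> ?K"
    have "(\<lambda>n. (1 - inverse (real (Suc n))) *\<^sub>R x) \<longlonglongrightarrow> (1 - 0) *\<^sub>R x"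
      by (intro tendsto_intros LIMSEQ_inverse_real_of_nat)
    moreover have "(1 - inverse (real (Suc n))) *\<^sub>R x \<in> region J \<xi>" for n
    proof -
      let ?t = "1 - inverse (real (Suc n))"
      have t: "0 \<le> ?t" "?t < 1" by (auto simp: field_simps)
      have "?t * (l C \<bullet> x) < c \<xi> C" if "C \<in> S" for C
      proof -
        have "?t * (l C \<bullet> x) \<le> ?t * c \<xi> C" using x t that by (intro mult_left_mono) auto
        also have "\<dots> < c \<xi> C" using c_pos[OF assms that] t by simp
        finally show ?thesis .
      qed
      then show ?thesis using x t assms by (simp add: region_eq orthant_scaleR)
    qed
    ultimately show "x \<in> closure (region J \<xi>)"
      unfolding closure_sequential by (intro exI[of _ "\<lambda>n. (1 - inverse (real (Suc n))) *\<^sub>R x"]) auto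
  qed
qed

lemma finite_supporting_hyperplanes:
  assumes "\<xi> \<in> orthant"
  shows "finite (supporting_hyperplanes J \<xi>)"
proof -
  have "closure (region J \<xi>) = orthant \<inter> (\<Inter>C\<in>S. {x. l C \<bullet> x \<le> c \<xi> C})"
    using assms by (auto simp: closure_region)
  moreover have "polyhedron (\<Inter>C\<in>S. {x. l C \<bullet> x \<le> c \<xi> C})"
    using finite_S by (intro polyhedron_Inter) (auto simp: polyhedron_halfspace_le)
  ultimately have "finite {\<Phi>. \<Phi> facet_of closure (region J \<xi>)}"
    by (simp add: finite_polyhedron_facets polyhedron_orthant)
  then have "finite ((hull) affine ` {\<Phi>. \<Phi> facet_of closure (region J \<xi>)})" by simp
  then show ?thesis
    by (rule finite_subset[rotated]) (auto simp: supporting_hyperplanes_def)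
qed

text \<open>Inside the orthant the complement of a region is a finite union of closed half-spaces,
  so removing one more region replaces each convex piece by finitely many, possibly overlapping,
  convex pieces.\<close>

lemma new_region_Union_convex:
  assumes "\<xi> \<in> orthant" "set D \<subseteq> orthant"
  shows "\<exists>\<F>. finite \<F> \<and> (\<forall>F\<in>\<F>. convex F) \<and> new_region J D \<xi> = \<Union>\<F>"
  using assms(2)
proof (induction D)
  case Nil
  have "region J \<xi> = orthant \<inter> (\<Inter>C\<in>S. {x. l C \<bullet> x < c \<xi> C})"
    using assms by (auto simp: region_eq)
  moreover have "convex \<dots>"
    by (auto intro!: convex_Int convex_orthant convex_INT convex_halfspace_lt)
  ultimately show ?case
    by (intro exI[of _ "{region J \<xi>}"]) (auto simp: new_region_def)
next
  case (Cons \<delta> D)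
  then obtain \<F> where \<F>: "finite \<F>" "\<forall>F\<in>\<F>. convex F" "new_region J D \<xi> = \<Union>\<F>" by auto
  let ?\<G> = "(\<lambda>(F, C). F \<inter> {x. l C \<bullet> x \<ge> c \<delta> C}) ` (\<F> \<times> S)"
  have "new_region J D \<xi> \<subseteq> orthant" by (auto simp: new_region_def region_def)
  moreover have "new_region J (\<delta> # D) \<xi> = new_region J D \<xi> - region J \<delta>"
    by (auto simp: new_region_def)
  ultimately have "new_region J (\<delta> # D) \<xi> = (\<Union>C\<in>S. new_region J D \<xi> \<inter> {x. l C \<bullet> x \<ge> c \<delta> C})"
    using Cons.prems by (fastforce simp: region_eq not_less)
  also have "\<dots> = \<Union>?\<G>" unfolding \<F> by auto
  finally show ?case
    using \<F> finite_S by (intro exI[of _ ?\<G>]) (auto intro!: convex_Int convex_halfspace_ge)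
qed

text \<open>This makes the rule \<open>new_ideal\<close> applicable, which asks for a list of the
  outer facets.\<close>

lemma finite_outer_facets:
  assumes "\<xi> \<in> orthant" "set D \<subseteq> orthant"
  shows "finite (outer_facets J D \<xi>)"
proof -
  have "finite (components (new_region J D \<xi>))"
    using new_region_Union_convex[OF assms] finite_components_Union_connected convex_connected
    by metis
  moreover have "finite (supporting_hyperplanes J \<xi>)"
    using assms(1) by (rule finite_supporting_hyperplanes)
  ultimately have "finite ((\<lambda>(H, Q). (H, (top_of_set orthant frontier_of Q) \<inter> H)) `
      (supporting_hyperplanes J \<xi> \<times> components (new_region J D \<xi>)))"
    by blast
  then show ?thesis
    by (rule finite_subset[rotated]) (auto simp: outer_facets_def)
qed

end

section \<open>Boundary points of half-spaces and exit points of rays\<close>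

lemma inner_pos_of_orthant:
  assumes "a \<in> orthant" "a \<noteq> 0" "\<And>i. 0 < x $ i"
  shows "0 < a \<bullet> x"
proof -
  obtain i where "a $ i \<noteq> 0" using assms(2) by (auto simp: vec_eq_iff)
  then have "0 < (\<Sum>i\<in>UNIV. a $ i * x $ i)"
    using assms by (intro sum_pos2[of _ i]) (auto simp: orthant_def less_le)
  then show ?thesis by (simp add: inner_vec_def)
qed

lemma open_strictly_between:
  fixes u v :: "real ^ 'r::finite"
  shows "open {x. \<forall>i. u $ i < x $ i \<and> x $ i < v $ i}"
proof -
  have "{x. \<forall>i. u $ i < x $ i \<and> x $ i < v $ i} =
      (\<Inter>i\<in>UNIV. {x. u $ i < x $ i} \<inter> {x. x $ i < v $ i})" by auto
  then show ?thesis
    by (auto intro!: open_INT open_Int open_Collect_less continuous_intros)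
qed

text \<open>Near \<open>b\<close> the set fills a half-ball. So it has full dimension, and its slice
  by the bounding hyperplane contains a relatively open piece of that hyperplane, which spans
  it.\<close>

lemma facet_of_Int_hyperplane:
  fixes K :: "'a::euclidean_space set"
  assumes K: "convex K" "\<And>x. x \<in> K \<Longrightarrow> a \<bullet> x \<le> k" and a: "a \<noteq> 0"
    and b: "a \<bullet> b = k" "0 < e" "ball b e \<inter> {x. a \<bullet> x \<le> k} \<subseteq> K"
  shows "(K \<inter> {x. a \<bullet> x = k}) facet_of K" "affine hull (K \<inter> {x. a \<bullet> x = k}) = {x. a \<bullet> x = k}"
proof -
  let ?H = "{x. a \<bullet> x = k}"
  have sub: "?H \<inter> ball b e \<subseteq> K \<inter> ?H" using b by auto
  have "b \<in> ?H \<inter> ball b e" using b by simp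
  then have "affine hull (?H \<inter> ball b e) = affine hull ?H"
    by (intro affine_hull_affine_Int_open affine_hyperplane open_ball) blast
  then have "affine hull (?H \<inter> ball b e) = ?H"
    by (simp add: hull_same affine_hyperplane)
  then have "?H \<subseteq> affine hull (K \<inter> ?H)" using hull_mono[OF sub, of affine] by simp
  moreover have "affine hull (K \<inter> ?H) \<subseteq> ?H"
    by (intro hull_minimal affine_hyperplane) auto
  ultimately show hull: "affine hull (K \<inter> ?H) = ?H" by blast
  have "aff_dim (K \<inter> ?H) = int DIM('a) - 1"
    using aff_dim_affine_hull[of "K \<inter> ?H"] a by (simp add: hull)
  moreover have "aff_dim K = int DIM('a)"
  proof -
    have "open (ball b e \<inter> {x. a \<bullet> x < k})" by (intro open_Int open_ball open_halfspace_lt)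
    \<comment> \<open>Half the radius away from \<open>b\<close>, straight into the open
      half-space.\<close>
    moreover have "b - (e / (2 * norm a)) *\<^sub>R a \<in> ball b e \<inter> {x. a \<bullet> x < k}"
      using a b by (auto simp: dist_norm inner_diff_right)
    moreover have "ball b e \<inter> {x. a \<bullet> x < k} \<subseteq> K" using b(3) by auto
    ultimately have "interior K \<noteq> {}" using interior_maximal by blast
    then show ?thesis by (rule aff_dim_nonempty_interior)
  qed
  moreover have "(K \<inter> ?H) face_of K"
    using K by (intro face_of_Int_supporting_hyperplane_le)
  moreover have "K \<inter> ?H \<noteq> {}" using b sub by auto
  ultimately show "(K \<inter> ?H) facet_of K" by (simp add: facet_of_def)
qed

text \<open>Step from \<open>y\<close> against the normal \<open>a\<close>, by less than both the
  prescribed distance and the distance left to the sphere.\<close>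

lemma in_closure_halfspace_Int_ball:
  fixes y :: "'a::real_inner"
  assumes "a \<noteq> 0" "a \<bullet> y = k" "y \<in> ball b e"
  shows "y \<in> closure (ball b e \<inter> {x. a \<bullet> x < k})"
  unfolding closure_approachable
proof (intro allI impI)
  fix d :: real assume "0 < d"
  define s where "s = min d (e - dist b y) / (2 * norm a)"
  have m: "0 < min d (e - dist b y)" using \<open>0 < d\<close> assms(3) by simp
  then have s: "0 < s" "s * norm a = min d (e - dist b y) / 2" using assms(1) by (simp_all add: s_def)
  have near: "dist (y - s *\<^sub>R a) y < min d (e - dist b y)"
    using s m by (simp add: dist_norm del: min_less_iff_conj)
  moreover have "y - s *\<^sub>R a \<in> ball b e"
    using near dist_triangle2[of b "y - s *\<^sub>R a" y] by (simp add: dist_commute)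
  moreover have "a \<bullet> (y - s *\<^sub>R a) < k"
    using assms s by (simp add: inner_diff_right)
  ultimately show "\<exists>x\<in>ball b e \<inter> {x. a \<bullet> x < k}. dist x y < d"
    by (intro bexI[of _ "y - s *\<^sub>R a"]) auto
qed

context open_regions
begin

text \<open>
  A linear form bounding \<open>region J z\<close> that attains its bound at \<open>y\<close> is constant on the hyperplane,
  as \<open>region J \<xi>\<close> is contained in \<open>region J z\<close>; but then it attains its bound at \<open>z\<close> as well.
\<close>

lemma facet_point_in_region:
  assumes \<xi>: "\<xi> \<in> orthant" and z: "z \<in> orthant" "J z \<subseteq> J \<xi>" "a \<bullet> z = k"
    and y: "y \<in> orthant" "a \<bullet> y = k"
    and e: "0 < e" "ball y e \<inter> {x. a \<bullet> x = k} \<subseteq> closure (region J \<xi>)"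
  shows "y \<in> region J z"
proof (rule ccontr)
  have "region J \<xi> \<subseteq> region J z" using z(2) by (auto simp: region_def)
  then have sub: "closure (region J \<xi>) \<subseteq> closure (region J z)" by (rule closure_mono)
  assume "y \<notin> region J z"
  then obtain C where C: "C \<in> S" "c z C \<le> l C \<bullet> y" using y z(1) by (auto simp: region_eq not_less)
  have "l C \<bullet> z = l C \<bullet> y"
  proof (rule linear_constant_on_hyperplane[OF y(2) e(1) _ z(3)])
    fix x assume "x \<in> ball y e" "a \<bullet> x = k"
    then have "x \<in> closure (region J z)" using e(2) sub by blast
    then show "l C \<bullet> x \<le> l C \<bullet> y" using C z(1) by (auto simp: closure_region)
  qed
  then show False using C self_in_region[OF z(1), of J] z(1) by (auto simp: region_eq)
qed

text \<open>
  The ray through \<open>q'\<close> is generic when \<open>q'\<close> avoids the linear hyperplanes spanned by the origin and the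
  intersection of two distinct bounding hyperplanes of the same region.
\<close>

lemma generic_exit_point:
  assumes D: "D \<noteq> []" "set D \<subseteq> orthant" and q: "q \<in> orthant" "q \<notin> (\<Union>\<delta>\<in>set D. region J \<delta>)"
  obtains D1 \<xi> D2 C b e where "D = D1 @ \<xi> # D2" "C \<in> S" "b \<in> region J q"
    "q + 1 - b \<in> orthant" "b \<notin> (\<Union>\<delta>\<in>set D. region J \<delta>)" "l C \<bullet> b = c \<xi> C"
    "0 < e" "ball b e \<subseteq> orthant"
    "new_region J D1 \<xi> \<inter> ball b e = ball b e \<inter> {x. l C \<bullet> x < c \<xi> C}"
proof -
  obtain V where V: "open V" "region J q = orthant \<inter> V" using region_open[OF q(1)] .
  \<comment> \<open>Candidates for the direction of the ray: points strictly above \<open>q\<close>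
    that still lie in its region, and less than 1 above it in each coordinate so that the exit point
    stays in a bounded box.\<close>
  define V' where "V' = V \<inter> {x. \<forall>i. q $ i < x $ i \<and> x $ i < (q + 1) $ i}"
  have "open V'" unfolding V'_def by (intro open_Int V open_strictly_between)
  moreover have "V' \<noteq> {}"
  proof -
    have "q \<in> V" using self_in_region[OF q(1), of J] V by auto
    then obtain r where r: "0 < r" "ball q r \<subseteq> V" using V(1) open_contains_ball by blast
    define s where "s = min (1/2) (r / (2 * norm (1 :: real ^ 'r)))"
    have n1: "0 < norm (1 :: real ^ 'r)" by simp
    have s: "0 < s" "s < 1" using r n1 by (auto simp: s_def)
    have "s * norm (1 :: real ^ 'r) \<le> r / (2 * norm (1 :: real ^ 'r)) * norm (1 :: real ^ 'r)"
      unfolding s_def by (intro mult_right_mono) auto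
    also have "\<dots> < r" using r n1 by simp
    finally have "q + s *\<^sub>R 1 \<in> V" using r s by (intro subsetD[OF r(2)]) (simp add: dist_norm)
    then have "q + s *\<^sub>R 1 \<in> V'" using s by (simp add: V'_def)
    then show ?thesis by blast
  qed
  \<comment> \<open>Two forms reaching their thresholds at the same point of the ray make this
    combination vanish at \<open>q'\<close>. Zero combinations come from constraints describing the
    same half-space and are left out.\<close>
  moreover define A where
    "A = (\<lambda>(\<delta>, C, C'). c \<delta> C' *\<^sub>R l C - c \<delta> C *\<^sub>R l C') ` (set D \<times> S \<times> S) - {0}"
  have "finite A" using finite_S by (simp add: A_def)
  ultimately obtain q' where q': "q' \<in> V'" and generic: "\<And>a. a \<in> A \<Longrightarrow> a \<bullet> q' \<noteq> 0"
    using ex_nonorthogonal_in_open[of A V'] unfolding A_def by blast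
  have above: "q $ i < q' $ i" "q' $ i < q $ i + 1" for i using q' by (simp_all add: V'_def)
  have pos: "0 < q' $ i" for i using above(1)[of i] q(1) by (auto simp: orthant_def intro: le_less_trans)
  have q'_orthant: "q' \<in> orthant" "q' - q \<in> orthant" "q + 1 - q' \<in> orthant"
    using pos above by (auto simp: orthant_def less_imp_le)
  have q'_region: "q' \<in> region J q" using q' V q'_orthant by (auto simp: V'_def)
  \<comment> \<open>Regions are downward closed, so a point above the uncovered \<open>q\<close> is
    uncovered.\<close>
  have q'_outside: "q' \<notin> region J \<delta>" if "\<delta> \<in> set D" for \<delta>
    using region_down[of \<delta> q' q] that D q q'_orthant by blast
  have lpos: "0 < l C \<bullet> q'" if "C \<in> S" for C
    using inner_pos_of_orthant[OF l_orthant l_nonzero] that pos by blast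
  \<comment> \<open>The parameter at which the ray \<open>t *\<^sub>R q'\<close> leaves the region
    of \<open>\<delta>\<close>; \<open>T\<close> below is the last such parameter over all processed
    points.\<close>
  define \<tau> where "\<tau> \<delta> = Min ((\<lambda>C. c \<delta> C / (l C \<bullet> q')) ` S)" for \<delta>
  have S_ne: "S \<noteq> {}"
    using q'_outside[of "hd D"] D q'_orthant by (auto simp: region_eq subset_iff)
  have \<tau>_attained: "\<exists>C\<in>S. \<tau> \<delta> = c \<delta> C / (l C \<bullet> q')" for \<delta>
    using Min_in[of "(\<lambda>C. c \<delta> C / (l C \<bullet> q')) ` S"] finite_S S_ne unfolding \<tau>_def by blast
  have \<tau>_le: "\<tau> \<delta> \<le> c \<delta> C / (l C \<bullet> q')" if "C \<in> S" for C \<delta>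
    using finite_S that by (simp add: \<tau>_def)
  define T where "T = Max (\<tau> ` set D)"
  have T_ge: "\<tau> \<delta> \<le> T" if "\<delta> \<in> set D" for \<delta> using that by (simp add: T_def)
  have "\<exists>\<delta>\<in>set D. \<tau> \<delta> = T"
  proof -
    have "T \<in> \<tau> ` set D" unfolding T_def using D(1) by (intro Max_in) auto
    then show ?thesis by blast
  qed
  \<comment> \<open>Choosing the first \<open>\<xi>\<close> that attains \<open>T\<close> ensures
    that all regions earlier in the list are left strictly before the exit point
    \<open>b\<close>.\<close>
  then obtain D1 \<xi> D2 where split: "D = D1 @ \<xi> # D2" "\<tau> \<xi> = T" "\<And>\<delta>. \<delta> \<in> set D1 \<Longrightarrow> \<tau> \<delta> \<noteq> T"
    using split_list_first_prop[of D "\<lambda>\<delta>. \<tau> \<delta> = T"] by blast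
  have orth: "\<xi> \<in> orthant" "set D1 \<subseteq> orthant" using D(2) split(1) by auto
  obtain C where C: "C \<in> S" "T = c \<xi> C / (l C \<bullet> q')" using \<tau>_attained[of \<xi>] split(2) by auto
  define b where "b = T *\<^sub>R q'"
  have T_pos: "0 < T" using C c_pos[OF orth(1) C(1)] lpos[OF C(1)] by simp
  \<comment> \<open>The uncovered point \<open>q'\<close> has parameter 1, so the ray has left all
    regions by then.\<close>
  have T_le: "T \<le> 1"
  proof -
    obtain C' where C': "C' \<in> S" "c \<xi> C' \<le> l C' \<bullet> q'"
      using q'_outside[of \<xi>] split(1) q'_orthant orth by (auto simp: region_eq not_less)
    then have "c \<xi> C' / (l C' \<bullet> q') \<le> 1" using lpos by simp
    then show ?thesis using \<tau>_le[OF C'(1), of \<xi>] split(2) by simp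
  qed
  have b_orthant: "b \<in> orthant" using T_pos q'_orthant by (simp add: b_def orthant_scaleR)
  have "q' - b = (1 - T) *\<^sub>R q'" by (simp add: b_def algebra_simps)
  then have q'_b: "q' - b \<in> orthant" using T_le q'_orthant by (simp add: orthant_scaleR)
  have lC: "l C \<bullet> b = c \<xi> C" using C lpos[OF C(1)] by (simp add: b_def)
  have outside: "b \<notin> region J \<delta>" if \<delta>: "\<delta> \<in> set D" for \<delta>
  proof -
    obtain C' where C': "C' \<in> S" "\<tau> \<delta> = c \<delta> C' / (l C' \<bullet> q')" using \<tau>_attained by blast
    then have "c \<delta> C' \<le> l C' \<bullet> b"
      using T_ge[OF \<delta>] lpos[OF C'(1)] by (simp add: b_def pos_divide_le_eq)
    moreover have "\<delta> \<in> orthant" using D(2) \<delta> by blast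
    ultimately show ?thesis using C'(1) by (force simp: region_eq)
  qed
  \<comment> \<open>A neighbourhood of \<open>b\<close> in which coordinates stay positive,
    constraints of \<open>\<xi>\<close> that are slack at \<open>b\<close> stay slack, and each
    earlier region stays excluded by a strictly violated constraint.\<close>
  define W where "W = {x. \<forall>i. 0 $ i < x $ i \<and> x $ i < (b + 1) $ i} \<inter> (\<Inter>C'\<in>{C'\<in>S. l C' \<bullet> b < c \<xi> C'}. {x. l C' \<bullet> x < c \<xi> C'})
      \<inter> (\<Inter>\<delta>\<in>set D1. \<Union>C'\<in>S. {x. l C' \<bullet> x > c \<delta> C'})"
  have "open W"
    unfolding W_def using finite_S
    by (intro open_Int open_strictly_between open_INT open_UN)
      (auto intro: open_halfspace_lt open_halfspace_gt)
  moreover have "b \<in> W"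
  proof -
    have "\<exists>C'\<in>S. c \<delta> C' < l C' \<bullet> b" if \<delta>: "\<delta> \<in> set D1" for \<delta>
    proof -
      obtain C' where C': "C' \<in> S" "\<tau> \<delta> = c \<delta> C' / (l C' \<bullet> q')" using \<tau>_attained by blast
      have "\<tau> \<delta> < T" using T_ge[of \<delta>] split \<delta> by (auto simp: less_le)
      then have "c \<delta> C' < l C' \<bullet> b"
        using C' lpos[OF C'(1)] by (simp add: b_def pos_divide_less_eq)
      then show ?thesis using C' by blast
    qed
    then show ?thesis using pos T_pos by (auto simp: W_def b_def)
  qed
  ultimately obtain e where e: "0 < e" "ball b e \<subseteq> W" using open_contains_ball by blast
  then have ball_orthant: "ball b e \<subseteq> orthant" by (auto simp: W_def orthant_def less_imp_le)
  have near_b: "x \<in> new_region J D1 \<xi> \<longleftrightarrow> l C \<bullet> x < c \<xi> C" if x: "x \<in> ball b e" for x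
  proof -
    have xW: "x \<in> W" using x e by blast
    have "x \<notin> region J \<delta>" if "\<delta> \<in> set D1" for \<delta>
    proof -
      have "\<forall>\<delta>\<in>set D1. \<exists>C'\<in>S. c \<delta> C' < l C' \<bullet> x" using xW by (simp add: W_def)
      from bspec[OF this that] obtain C' where "C' \<in> S" "c \<delta> C' < l C' \<bullet> x" ..
      moreover have "\<delta> \<in> orthant" using that orth by blast
      ultimately show ?thesis by (force simp: region_eq)
    qed
    then have "x \<in> new_region J D1 \<xi> \<longleftrightarrow> (\<forall>C'\<in>S. l C' \<bullet> x < c \<xi> C')"
      using ball_orthant x orth by (auto simp: new_region_def region_eq)
    also have "\<dots> \<longleftrightarrow> l C \<bullet> x < c \<xi> C"
    proof (intro iffI ballI)
      fix C' assume less: "l C \<bullet> x < c \<xi> C" and C': "C' \<in> S"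
      show "l C' \<bullet> x < c \<xi> C'"
      proof (cases "l C' \<bullet> b < c \<xi> C'")
        case True
        then show ?thesis using xW C' by (auto simp: W_def)
      next
        case False
        \<comment> \<open>Such a constraint is tight at \<open>b\<close>. Genericity of
          \<open>q'\<close> then forces the combination \<open>?a\<close> to be zero, so
          \<open>C'\<close> cuts out the same half-space as \<open>C\<close>.\<close>
        have "l C' \<bullet> b \<le> c \<xi> C'"
          using \<tau>_le[OF C', of \<xi>] split(2) lpos[OF C'] by (simp add: b_def pos_le_divide_eq)
        with False have eq: "l C' \<bullet> b = c \<xi> C'" by simp
        let ?a = "c \<xi> C' *\<^sub>R l C - c \<xi> C *\<^sub>R l C'"
        have "?a \<bullet> b = 0" using lC eq by (simp add: inner_diff_left)
        then have "?a \<bullet> q' = 0" using T_pos by (simp add: b_def)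
        moreover have "?a \<in> A" if "?a \<noteq> 0"
          unfolding A_def using that C C' split(1) by (intro DiffI image_eqI[of _ _ "(\<xi>, C, C')"]) auto
        ultimately have "?a = 0" using generic by blast
        then have "?a \<bullet> x = 0" by simp
        then have "c \<xi> C' * (l C \<bullet> x) = c \<xi> C * (l C' \<bullet> x)" by (simp add: inner_diff_left)
        moreover have "c \<xi> C' * (l C \<bullet> x) < c \<xi> C' * c \<xi> C"
          using less c_pos[OF orth(1) C'] by simp
        ultimately have "c \<xi> C * (l C' \<bullet> x) < c \<xi> C * c \<xi> C'" by (simp add: mult.commute)
        then show ?thesis using c_pos[OF orth(1) C(1)] by simp
      qed
    qed (use C in blast)
    finally show ?thesis .
  qed
  show thesis
  proof (rule that[OF split(1) C(1) _ _ _ lC e(1) ball_orthant])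
    show "b \<in> region J q" using region_down[OF q(1) q'_region b_orthant q'_b] .
    show "q + 1 - b \<in> orthant" using orthant_add[OF q'_orthant(3) q'_b] by (simp add: algebra_simps)
    show "b \<notin> (\<Union>\<delta>\<in>set D. region J \<delta>)" using outside by blast
    show "new_region J D1 \<xi> \<inter> ball b e = ball b e \<inter> {x. l C \<bullet> x < c \<xi> C}" using near_b by blast
  qed
qed

end

section \<open>The run of the algorithm\<close>

text \<open>New parts and outer facets are taken relative to \<open>D1\<close>, the points processed
  before \<open>\<xi>\<close>. Each point picked on an outer facet is tracked until it is processed;
  the point 0 guarantees a waiting point while \<open>D\<close> is empty.\<close>

definition algorithm_invariant :: "(real ^ 'r::finite \<Rightarrow> 'a set) \<Rightarrow> 'r algorithm_state \<Rightarrow> bool" where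
  "algorithm_invariant J s \<longleftrightarrow> (case s of (N, D) \<Rightarrow>
     set N \<union> set D \<subseteq> orthant \<and> 0 \<in> set N \<union> set D \<and>
     (\<forall>D1 \<xi> D2. D = D1 @ \<xi> # D2 \<longrightarrow>
        new_region J D1 \<xi> \<subseteq> {x. J x = J \<xi>} \<and>
        (\<forall>(H, \<Phi>)\<in>outer_facets J D1 \<xi>. \<exists>p\<in>set N \<union> set D. p \<in> top_of_set H interior_of \<Phi>)))"

lemma algorithm_invariant_orthant:
  assumes "algorithm_invariant J (N, D)"
  shows "set N \<subseteq> orthant" "set D \<subseteq> orthant"
  using assms by (simp_all add: algorithm_invariant_def)

lemma list_all2_rel_set:
  assumes "list_all2 P xs ys"
  shows "\<forall>x\<in>set xs. \<exists>y\<in>set ys. P x y" "\<forall>y\<in>set ys. \<exists>x\<in>set xs. P x y"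
  using assms by (induction rule: list_all2_induct) auto

lemma algorithm_step_set_mono:
  assumes "algorithm_step J (N, D) (N', D')"
  shows "set D \<subseteq> set D'" "set N \<union> set D \<subseteq> set N' \<union> set D'"
  using assms by (cases rule: algorithm_step.cases; auto simp: reorderable_def)+

section \<open>Consequences and preservation of the invariant\<close>

context open_regions
begin

text \<open>The first region in \<open>D\<close> that contains \<open>x\<close> has \<open>x\<close>
  in its new part, where the ideal is constant.\<close>

lemma represented_if_covered:
  assumes inv: "algorithm_invariant J (N, D)" and x: "x \<in> (\<Union>\<delta>\<in>set D. region J \<delta>)"
  shows "\<exists>\<delta>\<in>set D. J \<delta> = J x"
proof -
  obtain D1 \<xi> D2 where D: "D = D1 @ \<xi> # D2" "x \<in> region J \<xi>" "\<forall>\<delta>\<in>set D1. x \<notin> region J \<delta>"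
    using split_list_first_prop[of D "\<lambda>\<delta>. x \<in> region J \<delta>"] x by blast
  then have "x \<in> new_region J D1 \<xi>" by (simp add: new_region_def)
  then have "J x = J \<xi>" using inv D(1) unfolding algorithm_invariant_def by blast
  then show ?thesis using D(1) by auto
qed

text \<open>
  The point \<open>b\<close> where a generic ray leaves the union of the regions is an interior point of an outer
  facet, and all interior points of that facet, the picked one included, have the same ideal as \<open>b\<close>.
\<close>

lemma pending_point:
  assumes inv: "algorithm_invariant J (N, D)"
    and q: "q \<in> orthant" "q \<notin> (\<Union>\<delta>\<in>set D. region J \<delta>)"
  obtains p b where "p \<in> set N" "p \<in> region J q" "\<And>\<delta>. \<delta> \<in> set D \<Longrightarrow> J \<delta> \<noteq> J p"
    "b \<in> orthant" "q + 1 - b \<in> orthant" "J b = J p"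
proof (cases "D = []")
  case True
  \<comment> \<open>Nothing is processed yet, so 0 is waiting, and it lies below every point of the
    orthant.\<close>
  have "q - 0 \<in> orthant" using q by simp
  then have "0 \<in> region J q"
    using region_down[OF q(1) self_in_region[OF q(1)] zero_in_orthant] by simp
  moreover have "q + 1 - 0 \<in> orthant" using q(1) by (simp add: orthant_def)
  ultimately show ?thesis
    using that[of 0 0] inv True zero_in_orthant by (auto simp: algorithm_invariant_def)
next
  case False
  note ND = algorithm_invariant_orthant[OF inv]
  obtain D1 \<xi> D2 C b e where D: "D = D1 @ \<xi> # D2" and C: "C \<in> S" and bq: "b \<in> region J q"
    and le: "q + 1 - b \<in> orthant" and outside: "b \<notin> (\<Union>\<delta>\<in>set D. region J \<delta>)"
    and lC: "l C \<bullet> b = c \<xi> C" and e: "0 < e" and ball: "ball b e \<subseteq> orthant"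
    and near_b: "new_region J D1 \<xi> \<inter> ball b e = ball b e \<inter> {x. l C \<bullet> x < c \<xi> C}"
    using generic_exit_point[OF False ND(2) q] .
  have \<xi>: "\<xi> \<in> orthant" using D ND by auto
  have b: "b \<in> orthant" using bq by (simp add: in_region_iff)
  define H where "H = {x. l C \<bullet> x = c \<xi> C}"
  let ?B = "ball b e \<inter> {x. l C \<bullet> x < c \<xi> C}"
  have new_sub: "new_region J D1 \<xi> \<subseteq> region J \<xi>" by (auto simp: new_region_def)
  have H_disjoint: "H \<inter> region J \<xi> = {}"
    unfolding region_eq[OF \<xi>] H_def using C by force
  have H_closure: "y \<in> closure ?B" if "y \<in> H \<inter> ball b e" for y
    using that in_closure_halfspace_Int_ball[OF l_nonzero[OF C]] by (auto simp: H_def)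
  have "?B \<noteq> {}" using H_closure[of b] e lC by (auto simp: H_def)
  moreover have B_sub: "?B \<subseteq> new_region J D1 \<xi>" using near_b by blast
  ultimately have "new_region J D1 \<xi> \<noteq> {}" by blast
  moreover have "connected ?B"
    by (intro convex_connected convex_Int convex_ball convex_halfspace_lt)
  \<comment> \<open>The half-ball \<open>?B\<close> is connected, hence inside one component
    \<open>Q\<close>; its flat side consists of limits of \<open>?B\<close> outside the region,
    hence of boundary points of \<open>Q\<close>.\<close>
  ultimately obtain Q where Q: "Q \<in> components (new_region J D1 \<xi>)" "?B \<subseteq> Q"
    using exists_component_superset[OF B_sub] by blast
  have Q_sub: "Q \<subseteq> new_region J D1 \<xi>" using Q(1) by (rule in_components_subset)
  define \<Phi> where "\<Phi> = (top_of_set orthant frontier_of Q) \<inter> H"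
  have near: "H \<inter> ball b e \<subseteq> \<Phi>"
  proof
    fix y assume y: "y \<in> H \<inter> ball b e"
    have "y \<in> closure Q" using H_closure[OF y] closure_mono[OF Q(2)] by blast
    moreover have "Q \<subseteq> orthant" using Q_sub new_sub by (auto simp: region_def)
    ultimately have "y \<in> top_of_set orthant closure_of Q"
      using y ball by (auto simp: closure_of_subtopology Int_absorb1)
    moreover have "y \<notin> Q" using y H_disjoint Q_sub new_sub by blast
    ultimately show "y \<in> \<Phi>"
      using y interior_of_subset[of "top_of_set orthant" Q] by (auto simp: \<Phi>_def frontier_of_def)
  qed
  have \<Phi>_closure: "\<Phi> \<subseteq> closure Q"
    by (auto simp: \<Phi>_def frontier_of_def closure_of_subtopology intro: subsetD[OF closure_mono, rotated])
  have closure_Q: "closure Q \<subseteq> closure (region J \<xi>)"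
    using Q_sub new_sub by (intro closure_mono) blast
  have "openin (top_of_set H) (H \<inter> ball b e)" by (simp add: openin_open_Int)
  then have "b \<in> top_of_set H interior_of \<Phi>"
    using near lC e by (auto simp: interior_of_def H_def intro!: exI[of _ "H \<inter> ball b e"])
  \<comment> \<open>Near \<open>b\<close> the closed region fills the closed half-ball, so its slice
    by \<open>H\<close> is a facet spanning \<open>H\<close>. As \<open>H\<close> misses the region
    itself, the slice lies on the boundary taken in the orthant.\<close>
  moreover have "H \<in> supporting_hyperplanes J \<xi>"
  proof -
    let ?K = "closure (region J \<xi>)"
    have "region J \<xi> = orthant \<inter> (\<Inter>C\<in>S. {x. l C \<bullet> x < c \<xi> C})" using \<xi> by (auto simp: region_eq)
    then have "convex (region J \<xi>)"
      by (auto intro!: convex_Int convex_orthant convex_INT convex_halfspace_lt)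
    then have K: "convex ?K" by (rule convex_closure)
    have K_le: "\<And>x. x \<in> ?K \<Longrightarrow> l C \<bullet> x \<le> c \<xi> C" using C \<xi> by (auto simp: closure_region)
    have "ball b e \<inter> {x. l C \<bullet> x \<le> c \<xi> C} \<subseteq> ?K"
    proof
      fix x assume x: "x \<in> ball b e \<inter> {x. l C \<bullet> x \<le> c \<xi> C}"
      show "x \<in> ?K"
      proof (cases "l C \<bullet> x = c \<xi> C")
        case True
        then have "x \<in> H \<inter> ball b e" using x by (simp add: H_def)
        then show ?thesis using near \<Phi>_closure closure_Q by blast
      next
        case False
        then have "x \<in> region J \<xi>" using x B_sub new_sub by auto
        then show ?thesis using closure_subset by blast
      qed
    qed
    from facet_of_Int_hyperplane[OF K K_le l_nonzero[OF C] lC e this]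
    have "(?K \<inter> H) facet_of ?K" "affine hull (?K \<inter> H) = H" by (simp_all add: H_def)
    moreover have "?K \<inter> H \<subseteq> top_of_set orthant frontier_of region J \<xi>"
    proof
      fix x assume x: "x \<in> ?K \<inter> H"
      have sub: "region J \<xi> \<subseteq> orthant" by (auto simp: region_def)
      have "x \<in> orthant" using x \<xi> by (simp add: closure_region)
      moreover have "x \<notin> region J \<xi>" using x H_disjoint by blast
      ultimately show "x \<in> top_of_set orthant frontier_of region J \<xi>"
        using x sub interior_of_subset[of "top_of_set orthant" "region J \<xi>"]
        by (auto simp: frontier_of_def closure_of_subtopology Int_absorb1)
    qed
    ultimately show ?thesis unfolding supporting_hyperplanes_def by force
  qed
  ultimately have facet: "(H, \<Phi>) \<in> outer_facets J D1 \<xi>"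
    using Q(1) by (auto simp: outer_facets_def \<Phi>_def)
  then obtain p where p: "p \<in> set N \<union> set D" "p \<in> top_of_set H interior_of \<Phi>"
    using inv D unfolding algorithm_invariant_def by blast
  then obtain T where T: "openin (top_of_set H) T" "p \<in> T" "T \<subseteq> \<Phi>" by (auto simp: interior_of_def)
  then obtain e' where e': "0 < e'" "ball p e' \<inter> H \<subseteq> \<Phi>"
    unfolding openin_contains_ball by blast
  have p_orthant: "p \<in> orthant" using p ND by blast
  have pH: "l C \<bullet> p = c \<xi> C" using T by (auto simp: \<Phi>_def H_def)
  \<comment> \<open>The region of \<open>z\<close> is a relative neighbourhood of \<open>z\<close>,
    so it meets \<open>Q\<close>, and by the invariant all points of \<open>Q\<close> have the ideal
    of \<open>\<xi>\<close>.\<close>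
  have J_le: "J z \<subseteq> J \<xi>" if z: "z \<in> orthant" "z \<in> closure Q" for z
  proof -
    obtain V where V: "open V" "region J z = orthant \<inter> V" using region_open[OF z(1)] .
    have "z \<in> V" using self_in_region[OF z(1), of J] V by auto
    then have "V \<inter> Q \<noteq> {}" using z(2) open_Int_closure_eq_empty[OF V(1), of Q] by blast
    then obtain x where x: "x \<in> Q" "x \<in> V" by blast
    have "x \<in> orthant" using x Q_sub new_sub by (auto simp: region_def)
    then have "x \<in> region J z" using V x by blast
    then have "J z \<subseteq> J x" by (simp add: in_region_iff)
    also have "J x = J \<xi>" using x Q_sub inv D unfolding algorithm_invariant_def by blast
    finally show ?thesis .
  qed
  have "p \<in> closure Q" "b \<in> closure Q" using T near lC e \<Phi>_closure by (auto simp: H_def)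
  then have "J p \<subseteq> J \<xi>" "J b \<subseteq> J \<xi>" using J_le p_orthant b by blast+
  \<comment> \<open>Both \<open>p\<close> and \<open>b\<close> are interior to the facet, so the
    same argument with exchanged roles gives both inclusions of ideals.\<close>
  have "p \<in> region J b"
    using e' \<Phi>_closure closure_Q
    by (intro facet_point_in_region[OF \<xi> b \<open>J b \<subseteq> J \<xi>\<close> lC p_orthant pH, of e']) (auto simp: H_def)
  moreover have "b \<in> region J p"
    using e near \<Phi>_closure closure_Q
    by (intro facet_point_in_region[OF \<xi> p_orthant \<open>J p \<subseteq> J \<xi>\<close> pH b lC, of e]) (auto simp: H_def)
  ultimately have Jb: "J b = J p" by (auto simp: in_region_iff)
  \<comment> \<open>A processed point with this ideal would cover \<open>b\<close>. So
    \<open>p\<close> cannot be in \<open>D\<close> and must still be waiting.\<close>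
  then have unknown: "J \<delta> \<noteq> J p" if "\<delta> \<in> set D" for \<delta>
    using outside that b by (auto simp: in_region_iff)
  show ?thesis
  proof (rule that[OF _ _ unknown b le Jb])
    show "p \<in> set N" using p unknown by blast
    show "p \<in> region J q" using bq p_orthant Jb by (simp add: in_region_iff)
  qed
qed

text \<open>For \<open>q\<close> in the new part, some waiting \<open>p\<close> has an ideal
  containing that of \<open>q\<close>, hence that of \<open>\<xi>\<close>. As no reordering is
  possible, \<open>J p = J \<xi>\<close>, and \<open>J q\<close> is squeezed between the
  two.\<close>

lemma new_region_eq_ideal:
  assumes inv: "algorithm_invariant J (\<xi> # N, D)" and max: "\<nexists>\<nu>. reorderable J (\<xi> # N) \<nu>"
  shows "new_region J D \<xi> \<subseteq> {x. J x = J \<xi>}"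
proof
  fix q assume q: "q \<in> new_region J D \<xi>"
  then have q': "q \<in> orthant" "q \<notin> (\<Union>\<delta>\<in>set D. region J \<delta>)" "J \<xi> \<subseteq> J q"
    by (auto simp: new_region_def region_def)
  obtain p where p: "p \<in> set (\<xi> # N)" "p \<in> region J q"
    using pending_point[OF inv q'(1,2)] by metis
  have "p \<in> region J \<xi>" using p q' by (auto simp: in_region_iff)
  then have "J p = J \<xi>" using max p by (auto simp: reorderable_def)
  then show "q \<in> {x. J x = J \<xi>}" using p q' by (auto simp: in_region_iff)
qed

lemma algorithm_invariant_step:
  assumes inv: "algorithm_invariant J s" and step: "algorithm_step J s s'"
  shows "algorithm_invariant J s'"
proof -
  \<comment> \<open>Both rules that move \<open>\<xi>\<close> to \<open>D\<close> are treated at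
    once; \<open>P\<close> lists the points appended to \<open>N\<close>.\<close>
  have processed: "algorithm_invariant J (N @ P, D @ [\<xi>])"
    if inv: "algorithm_invariant J (\<xi> # N, D)" and max: "\<nexists>\<nu>. reorderable J (\<xi> # N) \<nu>"
      and P: "set P \<subseteq> orthant"
        "\<forall>(H, \<Phi>)\<in>outer_facets J D \<xi>. \<exists>p\<in>set P. p \<in> top_of_set H interior_of \<Phi>"
    for \<xi> N D P
    unfolding algorithm_invariant_def prod.case
  proof (intro conjI allI impI)
    show "set (N @ P) \<union> set (D @ [\<xi>]) \<subseteq> orthant" "0 \<in> set (N @ P) \<union> set (D @ [\<xi>])"
      using inv P by (auto simp: algorithm_invariant_def)
    fix D1 \<zeta> D2 assume split: "D @ [\<xi>] = D1 @ \<zeta> # D2"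
    have "new_region J D1 \<zeta> \<subseteq> {x. J x = J \<zeta>} \<and> (\<forall>(H, \<Phi>)\<in>outer_facets J D1 \<zeta>.
        \<exists>p\<in>set (N @ P) \<union> set (D @ [\<xi>]). p \<in> top_of_set H interior_of \<Phi>)"
    proof (cases D2 rule: rev_cases)
      case Nil
      then have "D1 = D" "\<zeta> = \<xi>" using split by auto
      then show ?thesis using new_region_eq_ideal[OF inv max] P(2) by (fastforce simp: case_prod_beta)
    next
      case (snoc D3 y)
      then have "D = D1 @ \<zeta> # D3" using split by auto
      then have "new_region J D1 \<zeta> \<subseteq> {x. J x = J \<zeta>} \<and> (\<forall>(H, \<Phi>)\<in>outer_facets J D1 \<zeta>.
          \<exists>p\<in>set (\<xi> # N) \<union> set D. p \<in> top_of_set H interior_of \<Phi>)"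
        using inv unfolding algorithm_invariant_def by blast
      then show ?thesis by (fastforce simp: case_prod_beta)
    qed
    then show "new_region J D1 \<zeta> \<subseteq> {x. J x = J \<zeta>}" "\<forall>(H, \<Phi>)\<in>outer_facets J D1 \<zeta>.
        \<exists>p\<in>set (N @ P) \<union> set (D @ [\<xi>]). p \<in> top_of_set H interior_of \<Phi>" by blast+
  qed
  from step inv show ?thesis
  proof (cases rule: algorithm_step.cases)
    case (reorder N \<nu> D)
    then have "set (\<nu> # remove1 \<nu> N) = set N"
      using set_remove1_subset[of \<nu> N] by (auto simp: reorderable_def) (metis in_set_remove1)+
    then show ?thesis using inv reorder by (simp add: algorithm_invariant_def)
  next
    case (known_ideal \<xi> N D)
    \<comment> \<open>A processed point with the same ideal has the same region, so no outer facet
      needs a picked point.\<close>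
    then have "new_region J D \<xi> = {}" by (auto simp: new_region_def region_def)
    then show ?thesis
      using processed[of \<xi> N D "[]"] known_ideal inv by (simp add: outer_facets_eq_empty)
  next
    case (new_ideal \<xi> N D facets picked)
    note picked = list_all2_rel_set[OF new_ideal(7)]
    have "\<forall>(H, \<Phi>)\<in>outer_facets J D \<xi>. \<exists>p\<in>set picked. p \<in> top_of_set H interior_of \<Phi>"
      using picked(1) unfolding new_ideal(6) case_prod_beta .
    moreover have "set picked \<subseteq> orthant"
    proof
      fix p assume "p \<in> set picked"
      then obtain z where "z \<in> outer_facets J D \<xi>" "p \<in> top_of_set (fst z) interior_of (snd z)"
        using picked(2) unfolding new_ideal(6) case_prod_beta by blast
      then show "p \<in> orthant"
        using outer_facet_subset_orthant[of "fst z" "snd z" J D \<xi>]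
          interior_of_subset[of "top_of_set (fst z)" "snd z"] by auto
    qed
    ultimately show ?thesis
      using processed[of \<xi> N D picked] new_ideal(1-3) inv by simp
  qed
qed

lemma algorithm_step_exists:
  assumes "algorithm_invariant J (N, D)" "N \<noteq> []"
  shows "\<exists>s. algorithm_step J (N, D) s"
proof -
  obtain \<xi> N' where N: "N = \<xi> # N'" using assms(2) by (cases N) auto
  have orth: "\<xi> \<in> orthant" "set D \<subseteq> orthant" using assms N by (auto simp: algorithm_invariant_def)
  consider "\<exists>\<nu>. reorderable J N \<nu>" | "\<nexists>\<nu>. reorderable J N \<nu>" "\<exists>\<delta>\<in>set D. J \<delta> = J \<xi>"
    | "\<nexists>\<nu>. reorderable J N \<nu>" "\<not> (\<exists>\<delta>\<in>set D. J \<delta> = J \<xi>)" by blast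
  then show ?thesis
  proof cases
    case 1
    then show ?thesis using algorithm_step.reorder by blast
  next
    case 2
    then show ?thesis using algorithm_step.known_ideal N by blast
  next
    case 3
    obtain facets where facets: "distinct facets" "set facets = outer_facets J D \<xi>"
      using finite_distinct_list[OF finite_outer_facets[OF orth]] by blast
    \<comment> \<open>Outer facets have nonempty relative interior by definition, so the choice is
      meaningful.\<close>
    let ?pick = "\<lambda>(H, \<Phi>). SOME p. p \<in> top_of_set H interior_of \<Phi>"
    have "list_all2 (\<lambda>(H, \<Phi>) p. p \<in> top_of_set H interior_of \<Phi>) facets (map ?pick facets)"
      using facets(2) unfolding list_all2_map2
      by (intro list.rel_refl_strong) (auto simp: outer_facets_def some_in_eq)
    then show ?thesis using algorithm_step.new_ideal 3 facets N by blast
  qed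
qed

section \<open>Maximal runs: processing of waiting points and representation of a box\<close>

context
  fixes \<sigma> :: "nat \<Rightarrow> 'r algorithm_state"
  assumes run: "algorithm_run J \<sigma>"
begin

lemma run_invariant: "algorithm_invariant J (\<sigma> n)"
proof (induction n)
  case 0
  then show ?case using run by (auto simp: algorithm_run_def algorithm_invariant_def zero_in_orthant)
next
  case (Suc n)
  then show ?case using run algorithm_invariant_step unfolding algorithm_run_def by metis
qed

lemma run_step_if_pending:
  assumes "fst (\<sigma> n) \<noteq> []"
  shows "algorithm_step J (\<sigma> n) (\<sigma> (Suc n))"
  using algorithm_step_exists[of "fst (\<sigma> n)" "snd (\<sigma> n)"] run_invariant[of n] assms run
  unfolding algorithm_run_def prod.collapse by metis

lemma run_set_mono_Suc:
  "set (snd (\<sigma> n)) \<subseteq> set (snd (\<sigma> (Suc n)))"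
  "set (fst (\<sigma> n)) \<union> set (snd (\<sigma> n)) \<subseteq> set (fst (\<sigma> (Suc n))) \<union> set (snd (\<sigma> (Suc n)))"
  using run algorithm_step_set_mono[of J "fst (\<sigma> n)" "snd (\<sigma> n)" "fst (\<sigma> (Suc n))" "snd (\<sigma> (Suc n))"]
  unfolding algorithm_run_def prod.collapse by (metis order_refl)+

lemma run_set_mono:
  assumes "n \<le> m"
  shows "set (snd (\<sigma> n)) \<subseteq> set (snd (\<sigma> m))"
    "set (fst (\<sigma> n)) \<union> set (snd (\<sigma> n)) \<subseteq> set (fst (\<sigma> m)) \<union> set (snd (\<sigma> m))"
  using lift_Suc_mono_le[of "\<lambda>n. set (snd (\<sigma> n))"]
    lift_Suc_mono_le[of "\<lambda>n. set (fst (\<sigma> n)) \<union> set (snd (\<sigma> n))"] run_set_mono_Suc assms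
  by blast+

text \<open>
  While \<open>p\<close> waits, only points whose ideal lies in a finite upward closed set \<open>W\<close> can get ahead of it.
  So eventually no new ideal is found, then no point is removed, and then no reordering is possible.
\<close>

lemma pending_eventually_done:
  assumes p: "p \<in> set (fst (\<sigma> n))"
  shows "\<exists>m\<ge>n. p \<in> set (snd (\<sigma> m))"
proof (rule ccontr)
  assume "\<not> ?thesis"
  then have not_done: "p \<notin> set (snd (\<sigma> m))" if "n \<le> m" for m using that by blast
  \<comment> \<open>The ideals of points that contain the ideal of some point waiting at time
    \<open>n\<close>.\<close>
  define W where "W = (\<Union>a\<in>set (fst (\<sigma> n)). J ` region J a)"
  have orth: "set (fst (\<sigma> m)) \<union> set (snd (\<sigma> m)) \<subseteq> orthant" for m
    using algorithm_invariant_orthant[of J "fst (\<sigma> m)" "snd (\<sigma> m)"] run_invariant[of m] by simp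
  have finite_W: "finite W"
    unfolding W_def using orth[of n] by (intro finite_UN_I finite_values) auto
  have up: "J y \<in> W" if xy: "J x \<in> W" "y \<in> region J x" for x y
  proof -
    obtain a z where a: "a \<in> set (fst (\<sigma> n))" "z \<in> region J a" "J x = J z"
      using xy(1) unfolding W_def by blast
    then have "y \<in> region J a" using xy(2) unfolding in_region_iff by auto
    then show ?thesis using a(1) unfolding W_def by blast
  qed
  have start_W: "J a \<in> W" if "a \<in> set (fst (\<sigma> n))" for a
    using that orth[of n] self_in_region[of a J] unfolding W_def by blast
  \<comment> \<open>Reordering only moves forward a point whose ideal contains that of the head, and
    newly picked points are appended behind \<open>p\<close>.\<close>
  let ?ahead = "\<lambda>N. \<exists>pre post. N = pre @ p # post \<and> (\<forall>a\<in>set pre. J a \<in> W)"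
  have ahead: "?ahead (fst (\<sigma> m))" if "n \<le> m" for m
    using that
  proof (induction m rule: dec_induct)
    case base
    from split_list[OF p] obtain pre post where "fst (\<sigma> n) = pre @ p # post" by blast
    then show ?case using start_W by (intro exI[of _ pre] exI[of _ post]) auto
  next
    case (step m)
    then obtain pre post where N: "fst (\<sigma> m) = pre @ p # post" "\<forall>a\<in>set pre. J a \<in> W" by blast
    have "algorithm_step J (\<sigma> m) (\<sigma> (Suc m))" using N by (intro run_step_if_pending) simp
    then show ?case
    proof (cases rule: algorithm_step.cases)
      case (reorder N' \<nu> D)
      then have N': "N' = pre @ p # post" using N by simp
      have "J (hd N') \<in> W" using N' N(2) start_W[OF p] by (cases pre) auto
      then have \<nu>: "J \<nu> \<in> W" using up reorder by (auto simp: reorderable_def)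
      consider "\<nu> \<in> set pre" | "\<nu> \<notin> set pre" "\<nu> = p" | "\<nu> \<notin> set pre" "\<nu> \<noteq> p" by blast
      then show ?thesis
      proof cases
        case 1
        then have "fst (\<sigma> (Suc m)) = (\<nu> # remove1 \<nu> pre) @ p # post"
          using reorder N' by (simp add: remove1_append)
        then show ?thesis using N(2) \<nu> set_remove1_subset[of \<nu> pre]
          by (intro exI[of _ "\<nu> # remove1 \<nu> pre"] exI[of _ post]) auto
      next
        case 2
        then show ?thesis using reorder by (intro exI[of _ "[]"] exI[of _ "remove1 p N'"]) simp
      next
        case 3
        then have "fst (\<sigma> (Suc m)) = (\<nu> # pre) @ p # remove1 \<nu> post"
          using reorder N' by (simp add: remove1_append)
        then show ?thesis using N(2) \<nu> by (intro exI[of _ "\<nu> # pre"] exI[of _ "remove1 \<nu> post"]) auto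
      qed
    next
      case (known_ideal \<xi> N' D)
      then have "\<xi> \<noteq> p" using not_done[of "Suc m"] step.hyps by auto
      then show ?thesis using known_ideal N by (cases pre) auto
    next
      case (new_ideal \<xi> N' D facets picked)
      then have "\<xi> \<noteq> p" using not_done[of "Suc m"] step.hyps by auto
      then obtain pre' where "pre = \<xi> # pre'" "N' = pre' @ p # post"
        using new_ideal N by (cases pre) auto
      then show ?thesis using new_ideal N(2)
        by (intro exI[of _ pre'] exI[of _ "post @ picked"]) auto
    qed
  qed
  \<comment> \<open>The entries count the ideals of \<open>W\<close> not yet found, the waiting
    points, and the ideals of \<open>W\<close> strictly containing that of the head.
    \<open>new_ideal\<close> lowers the first, although \<open>N\<close> may grow;
    \<open>known_ideal\<close> keeps the first and lowers the second; \<open>reorder\<close> keeps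
    both and lowers the third.\<close>
  define \<mu> where "\<mu> m = (card (W - J ` set (snd (\<sigma> m))), length (fst (\<sigma> m)),
      card {w \<in> W. J (hd (fst (\<sigma> m))) \<subset> w})" for m
  have "(\<mu> (Suc m), \<mu> m) \<in> less_than <*lex*> less_than <*lex*> less_than" if m: "n \<le> m" for m
  proof -
    obtain pre post where N: "fst (\<sigma> m) = pre @ p # post" "\<forall>a\<in>set pre. J a \<in> W"
      using ahead[OF m] by blast
    have hd_W: "J (hd (fst (\<sigma> m))) \<in> W" using N start_W[OF p] by (cases pre) auto
    have "algorithm_step J (\<sigma> m) (\<sigma> (Suc m))" using N by (intro run_step_if_pending) simp
    then show ?thesis
    proof (cases rule: algorithm_step.cases)
      case (reorder N' \<nu> D)
      have \<nu>: "J \<nu> \<in> W" "J (hd N') \<subset> J \<nu>"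
        using up[OF hd_W, of \<nu>] reorder by (auto simp: reorderable_def in_region_iff)
      then have "card {w \<in> W. J \<nu> \<subset> w} < card {w \<in> W. J (hd N') \<subset> w}"
        using finite_W by (intro psubset_card_mono) auto
      moreover have "length (\<nu> # remove1 \<nu> N') = length N'"
        using reorder(3) length_pos_if_in_set[of \<nu> N'] by (simp add: reorderable_def length_remove1)
      ultimately show ?thesis using reorder by (simp add: \<mu>_def)
    next
      case (known_ideal \<xi> N' D)
      then have "card (W - J ` set (snd (\<sigma> (Suc m)))) = card (W - J ` set (snd (\<sigma> m)))"
        by (intro arg_cong[of _ _ card]) auto
      then show ?thesis using known_ideal by (simp add: \<mu>_def)
    next
      case (new_ideal \<xi> N' D facets picked)
      then have "J \<xi> \<in> W - J ` set D" using hd_W by auto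
      then have "card (W - J ` set (D @ [\<xi>])) < card (W - J ` set D)"
        using finite_W by (intro psubset_card_mono) auto
      then show ?thesis using new_ideal by (simp add: \<mu>_def)
    qed
  qed
  moreover have "wf (less_than <*lex*> less_than <*lex*> less_than)" by auto
  then obtain k where "(\<mu> (n + Suc k), \<mu> (n + k)) \<notin> less_than <*lex*> less_than <*lex*> less_than"
    by (rule wf_no_infinite_down_chainE[where f = "\<lambda>k. \<mu> (n + k)"])
  ultimately show False by simp
qed

text \<open>The ideals of an enlarged box found so far form an increasing sequence of subsets of a
  finite set. Once this subset is largest, an uncovered point would yield a waiting point whose
  later processing enlarges it.\<close>

lemma run_represents_box:
  assumes \<Lambda>: "\<Lambda> \<in> orthant"
  shows "\<exists>n. \<forall>x\<in>orthant. \<Lambda> - x \<in> orthant \<longrightarrow> (\<exists>\<delta>\<in>set (snd (\<sigma> n)). \<delta> \<in> constancy_region J x)"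
proof -
  \<comment> \<open>The margin 1 leaves room for the point \<open>b\<close> of
    \<open>pending_point\<close>, which may exceed the given point by up to 1 in each
    coordinate.\<close>
  define \<J> where "\<J> = J ` {x \<in> orthant. \<Lambda> + 1 - x \<in> orthant}"
  have top: "\<Lambda> + 1 \<in> orthant" using \<Lambda> by (simp add: orthant_def)
  \<comment> \<open>The box lies below its upper corner, hence in the region of that corner, where
    only finitely many ideals occur.\<close>
  have "{x \<in> orthant. \<Lambda> + 1 - x \<in> orthant} \<subseteq> region J (\<Lambda> + 1)"
    using region_down[OF top self_in_region[OF top]] by blast
  then have fin: "finite \<J>" using finite_values[OF top] unfolding \<J>_def by (meson finite_subset image_mono)
  define found where "found n = \<J> \<inter> J ` set (snd (\<sigma> n))" for n
  have "card (found n) < Suc (card \<J>)" for n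
    using fin by (auto simp: found_def less_Suc_eq_le intro: card_mono)
  then obtain n where n: "\<And>m. card (found m) \<le> card (found n)"
    using ex_has_greatest_nat[of "\<lambda>_. True" 0 "\<lambda>n. card (found n)"] by blast
  show ?thesis
  proof (intro exI[of _ n] ballI impI)
    fix x assume x: "x \<in> orthant" "\<Lambda> - x \<in> orthant"
    have inv: "algorithm_invariant J (fst (\<sigma> n), snd (\<sigma> n))" using run_invariant[of n] by simp
    show "\<exists>\<delta>\<in>set (snd (\<sigma> n)). \<delta> \<in> constancy_region J x"
    proof (cases "x \<in> (\<Union>\<delta>\<in>set (snd (\<sigma> n)). region J \<delta>)")
      case True
      then obtain \<delta> where "\<delta> \<in> set (snd (\<sigma> n))" "J \<delta> = J x"
        using represented_if_covered[OF inv] by blast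
      moreover have "set (snd (\<sigma> n)) \<subseteq> orthant"
        using inv by (rule algorithm_invariant_orthant)
      ultimately show ?thesis by (auto simp: constancy_region_def)
    next
      case False
      obtain p b where p: "p \<in> set (fst (\<sigma> n))" "\<And>\<delta>. \<delta> \<in> set (snd (\<sigma> n)) \<Longrightarrow> J \<delta> \<noteq> J p"
        and b: "b \<in> orthant" "x + 1 - b \<in> orthant" "J b = J p"
        using pending_point[OF inv x(1) False] by metis
      have "\<Lambda> + 1 - b \<in> orthant" using orthant_add[OF x(2) b(2)] by (simp add: algebra_simps)
      then have "J p \<in> \<J>" using b by (auto simp: \<J>_def image_iff)
      moreover obtain m where m: "n \<le> m" "p \<in> set (snd (\<sigma> m))"
        using pending_eventually_done[OF p(1)] by blast
      ultimately have "J p \<in> found m" by (simp add: found_def)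
      moreover have "J p \<notin> found n" using p(2) by (auto simp: found_def)
      moreover have "found n \<subseteq> found m" using run_set_mono(1)[OF m(1)] by (auto simp: found_def)
      ultimately have "found n \<subset> found m" by blast
      then have "card (found n) < card (found m)"
        using fin by (intro psubset_card_mono) (auto simp: found_def)
      then show ?thesis using n[of m] by simp
    qed
  qed
qed

end

end

section \<open>Orders along the prime divisors of a model\<close>

lemma ring_on_simps [simp]:
  "carrier (ring_on A) = A" "x \<otimes>\<^bsub>ring_on A\<^esub> y = x * y" "\<one>\<^bsub>ring_on A\<^esub> = 1"
  "\<zero>\<^bsub>ring_on A\<^esub> = 0" "x \<oplus>\<^bsub>ring_on A\<^esub> y = x + y"
  by (simp_all add: ring_on_def)

lemma cring_ring_on:
  fixes A :: "'k::field set"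
  assumes "0 \<in> A" "1 \<in> A" "\<And>x. x \<in> A \<Longrightarrow> - x \<in> A"
    "\<And>x y. x \<in> A \<Longrightarrow> y \<in> A \<Longrightarrow> x + y \<in> A" "\<And>x y. x \<in> A \<Longrightarrow> y \<in> A \<Longrightarrow> x * y \<in> A"
  shows "cring (ring_on A)"
proof (rule cringI)
  show "abelian_group (ring_on A)"
  proof (rule abelian_groupI)
    fix x assume "x \<in> carrier (ring_on A)"
    then show "\<exists>y\<in>carrier (ring_on A). y \<oplus>\<^bsub>ring_on A\<^esub> x = \<zero>\<^bsub>ring_on A\<^esub>"
      using assms by (intro bexI[of _ "- x"]) auto
  qed (use assms in \<open>auto simp: algebra_simps\<close>)
  show "comm_monoid (ring_on A)"
    by (rule comm_monoidI) (use assms in \<open>auto simp: algebra_simps\<close>)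
qed (use assms in \<open>auto simp: algebra_simps\<close>)

lemma subring_ring_onD:
  fixes A :: "'k::field set"
  assumes "subring A (ring_on UNIV)"
  shows "0 \<in> A" "1 \<in> A" "\<And>x. x \<in> A \<Longrightarrow> - x \<in> A"
    "\<And>x y. x \<in> A \<Longrightarrow> y \<in> A \<Longrightarrow> x + y \<in> A" "\<And>x y. x \<in> A \<Longrightarrow> y \<in> A \<Longrightarrow> x * y \<in> A"
    and "cring (ring_on A)"
proof -
  interpret U: cring "ring_on (UNIV :: 'k set)" by (rule cring_ring_on) auto
  have "\<ominus>\<^bsub>ring_on UNIV\<^esub> x = - x" for x :: 'k
    using U.minus_equality[of "- x" x] by simp
  then show *: "0 \<in> A" "1 \<in> A" "\<And>x. x \<in> A \<Longrightarrow> - x \<in> A"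
    "\<And>x y. x \<in> A \<Longrightarrow> y \<in> A \<Longrightarrow> x + y \<in> A" "\<And>x y. x \<in> A \<Longrightarrow> y \<in> A \<Longrightarrow> x * y \<in> A"
    using subringE[OF assms] by auto
  then show "cring (ring_on A)" by (intro cring_ring_on)
qed

text \<open>Zorn's lemma applies because in a noetherian ring a nonempty chain of ideals contains
  its union.\<close>

lemma (in noetherian_ring) proper_ideal_subset_maximal:
  assumes "ideal I R" "I \<noteq> carrier R"
  shows "\<exists>M. maximalideal M R \<and> I \<subseteq> M"
proof -
  let ?A = "{K. ideal K R \<and> I \<subseteq> K \<and> K \<noteq> carrier R}"
  have "\<exists>M\<in>?A. \<forall>X\<in>?A. M \<subseteq> X \<longrightarrow> X = M"
  proof (rule subset_Zorn_nonempty)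
    show "?A \<noteq> {}" using assms by blast
    fix \<C> assume C: "\<C> \<noteq> {}" "subset.chain ?A \<C>"
    then have "subset.chain {K. ideal K R} \<C>" by (auto simp: pred_on.chain_def)
    with C(1) have "\<Union>\<C> \<in> \<C>" by (rule ideal_chain_is_trivial)
    then show "\<Union>\<C> \<in> ?A" using C(2) by (auto simp: pred_on.chain_def)
  qed
  then obtain M where M: "M \<in> ?A" and max: "\<forall>X\<in>?A. M \<subseteq> X \<longrightarrow> X = M" ..
  have "maximalideal M R"
  proof (rule maximalidealI)
    fix X assume X: "ideal X R" "M \<subseteq> X" "X \<subseteq> carrier R"
    show "X = M \<or> X = carrier R"
    proof (cases "X = carrier R")
      case False
      then have "X \<in> ?A" using X M by auto
      then show ?thesis using max X(2) by simp
    qed simp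
  qed (use M in auto)
  then show ?thesis using M by blast
qed

section \<open>Discrete valuation rings as one-dimensional regular local rings\<close>

locale discrete_valuation_ring =
  fixes C :: "'k::field set" and t :: 'k
  assumes regular: "regular_local_ring C" and dim: "krull_dim C = 1"
    and uniformizer: "max_ideal C = genideal (ring_on C) {t}"
begin

lemma is_subring: "subring C (ring_on UNIV)"
  using regular by (simp add: regular_local_ring_def local_ring_def)

lemmas closed = subring_ring_onD(1-5)[OF is_subring]

sublocale cring "ring_on C"
  using is_subring by (rule subring_ring_onD)

sublocale noetherian_ring "ring_on C"
  using regular by (simp add: regular_local_ring_def)

lemma power_closed: "x \<in> C \<Longrightarrow> x ^ n \<in> C"
  by (induction n) (auto intro: closed)

lemma ex1_maximal: "\<exists>!M. maximalideal M (ring_on C)"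
  using regular by (simp add: regular_local_ring_def local_ring_def)

lemma maximal: "maximalideal (max_ideal C) (ring_on C)"
  unfolding max_ideal_def using ex1_maximal by (rule theI')

lemma one_notin_max_ideal: "1 \<notin> max_ideal C"
  using ideal.one_imp_carrier[OF maximalideal.axioms(1)[OF maximal]] maximalideal.I_notcarr[OF maximal]
  by auto

text \<open>\<open>genideal\<close> intersects all ideals containing the generators. For a generator
  outside \<open>C\<close> there is no such ideal, and the empty intersection \<open>UNIV\<close>
  contains 1.\<close>

lemma generator_in:
  assumes "max_ideal C = genideal (ring_on C) {s}"
  shows "s \<in> C"
proof (rule ccontr)
  assume "s \<notin> C"
  then have "\<not> (\<exists>I. ideal I (ring_on C) \<and> {s} \<subseteq> I)"
    using additive_subgroup.a_subset[OF ideal.axioms(1)] by fastforce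
  then have "genideal (ring_on C) {s} = UNIV" by (auto simp: genideal_def)
  then show False using assms one_notin_max_ideal by simp
qed

lemma max_ideal_eq:
  assumes "max_ideal C = genideal (ring_on C) {s}"
  shows "max_ideal C = {x * s |x. x \<in> C}"
  using cgenideal_eq_genideal[of s] generator_in[OF assms] assms by (simp add: cgenideal_def)

lemmas uniformizer_in = generator_in[OF uniformizer]

text \<open>A non-unit generates a proper ideal, which lies in the only maximal ideal.\<close>

lemma inverse_in_if_notin_max_ideal:
  assumes u: "u \<in> C" "u \<notin> max_ideal C"
  shows "inverse u \<in> C"
proof (rule ccontr)
  assume "inverse u \<notin> C"
  have u0: "u \<noteq> 0" using u ideal.Icarr additive_subgroup.zero_closed[OF ideal.axioms(1)[OF
    maximalideal.axioms(1)[OF maximal]]] by auto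
  have "1 \<notin> {x * u |x. x \<in> C}"
  proof
    assume "1 \<in> {x * u |x. x \<in> C}"
    then obtain x where "x \<in> C" "u * x = 1" by (auto simp: mult.commute)
    then show False using inverse_unique[of u x] \<open>inverse u \<notin> C\<close> by simp
  qed
  then have "cgenideal (ring_on C) u \<noteq> carrier (ring_on C)"
    unfolding cgenideal_def ring_on_simps using closed(2) by metis
  then obtain M where M: "maximalideal M (ring_on C)" "cgenideal (ring_on C) u \<subseteq> M"
    using proper_ideal_subset_maximal[OF cgenideal_ideal[of u]] u by auto
  then have "M = max_ideal C" using ex1_maximal maximal by blast
  then show False using M(2) cgenideal_self[of u] u by auto
qed

text \<open>Otherwise every nonzero element is a unit, so no prime but the zero ideal is possible
  and the dimension is 0.\<close>

lemma uniformizer_nonzero: "t \<noteq> 0"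
proof
  assume "t = 0"
  then have zero: "max_ideal C = {0}" using max_ideal_eq[OF uniformizer] closed by auto
  have prime_zero: "P = {0}" if P: "primeideal P (ring_on C)" for P
  proof -
    have id: "ideal P (ring_on C)" using P by (rule primeideal.axioms(1))
    have "x = 0" if x: "x \<in> P" for x
    proof (rule ccontr)
      assume "x \<noteq> 0"
      moreover have "x \<in> C" using ideal.Icarr[OF id x] by simp
      ultimately have "inverse x \<in> C" using inverse_in_if_notin_max_ideal zero by auto
      then have "inverse x * x \<in> P" using ideal.I_l_closed[OF id x] by simp
      then have "1 \<in> P" using \<open>x \<noteq> 0\<close> by simp
      then show False using ideal.one_imp_carrier[OF id] primeideal.I_notcarr[OF P] by auto
    qed
    moreover have "0 \<in> P" using additive_subgroup.zero_closed[OF ideal.axioms(1)[OF id]] by simp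
    ultimately show ?thesis by blast
  qed
  have "krull_dim C \<le> 0"
    unfolding krull_dim_def
  proof (rule Sup_least)
    fix d assume "d \<in> {enat n |n. \<exists>P :: nat \<Rightarrow> 'k set.
       (\<forall>i\<le>n. primeideal (P i) (ring_on C)) \<and> (\<forall>i<n. P i \<subset> P (Suc i))}"
    then obtain n P where d: "d = enat n" "\<And>i. i \<le> n \<Longrightarrow> primeideal (P i) (ring_on C)"
      "\<And>i. i < n \<Longrightarrow> P i \<subset> P (Suc i)" by blast
    have "n = 0"
    proof (rule ccontr)
      assume "n \<noteq> 0"
      then have "P 0 = {0}" "P (Suc 0) = {0}" "P 0 \<subset> P (Suc 0)"
        using prime_zero[OF d(2)] d(3) by auto
      then show False by simp
    qed
    then show "d \<le> 0" using d(1) by (simp add: zero_enat_def)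
  qed
  then show False using dim by simp
qed

lemma inverse_uniformizer_notin: "inverse t \<notin> C"
proof
  assume "inverse t \<in> C"
  then have "inverse t * t \<in> max_ideal C" unfolding max_ideal_eq[OF uniformizer] by blast
  then show False using uniformizer_nonzero one_notin_max_ideal by simp
qed

definition units :: "'k set" where
  "units = {u \<in> C. inverse u \<in> C \<and> u \<noteq> 0}"

lemma units_mult: "u \<in> units \<Longrightarrow> v \<in> units \<Longrightarrow> u * v \<in> units"
  by (auto simp: units_def intro: closed)

lemma units_inverse: "u \<in> units \<Longrightarrow> inverse u \<in> units"
  by (auto simp: units_def)

lemma units_powi: "u \<in> units \<Longrightarrow> u powi n \<in> units"
  by (auto simp: units_def power_int_def power_inverse[symmetric] intro: power_closed)

lemma uniformizer_powi_unit_imp_nonpos: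
  assumes "t powi n \<in> units"
  shows "n \<le> 0"
proof (rule ccontr)
  assume "\<not> n \<le> 0"
  then obtain k where n: "n = int (Suc k)" by (metis gr0_implies_Suc linorder_not_le zero_less_imp_eq_int)
  have "inverse (t ^ Suc k) * t ^ k \<in> C"
    using assms unfolding n power_int_of_nat
    by (intro closed power_closed uniformizer_in) (simp add: units_def del: power_Suc)
  then show False using inverse_uniformizer_notin uniformizer_nonzero by (simp add: field_simps)
qed

text \<open>Two uniformizers differ by a unit, so the exponent in the definition of the order does
  not depend on the one chosen.\<close>

lemma ord_along_eq:
  assumes "u \<in> units"
  shows "ord_along C (t powi n * u) = n"
  unfolding ord_along_def
proof (rule the_equality)
  show "\<exists>s v. max_ideal C = genideal (ring_on C) {s} \<and> v \<in> C \<and> inverse v \<in> C \<and> v \<noteq> 0 \<and>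
      t powi n * u = s powi n * v"
    using assms uniformizer unfolding units_def by blast
next
  fix m assume "\<exists>s v. max_ideal C = genideal (ring_on C) {s} \<and> v \<in> C \<and> inverse v \<in> C \<and> v \<noteq> 0 \<and>
      t powi n * u = s powi m * v"
  then obtain s v where s: "max_ideal C = genideal (ring_on C) {s}" and v: "v \<in> units"
    and eq: "t powi n * u = s powi m * v" unfolding units_def by blast
  have "s \<in> max_ideal C" "t \<in> max_ideal C"
    using s uniformizer generator_in genideal_self'[of s] genideal_self'[of t] uniformizer_in by auto
  then obtain x y where xy: "x \<in> C" "y \<in> C" "s = x * t" "t = y * s"
    using max_ideal_eq[OF s] max_ideal_eq[OF uniformizer] by blast
  then have "x * y = 1" using uniformizer_nonzero by (metis mult.assoc mult.commute mult_cancel_right1)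
  then have x: "x \<in> units" using xy inverse_unique[of x y] by (auto simp: units_def)
  have nz: "t \<noteq> 0" "u \<noteq> 0" "v \<noteq> 0" "x \<noteq> 0"
    using uniformizer_nonzero assms v x by (auto simp: units_def)
  define w where "w = x powi m * v * inverse u"
  have w: "w \<in> units" unfolding w_def by (intro units_mult units_powi units_inverse assms v x)
  have "t powi n = t powi m * w"
    using eq nz unfolding w_def xy(3) by (simp add: power_int_mult_distrib field_simps)
  \<comment> \<open>A power of \<open>t\<close> and its inverse are both units, so neither exponent
    is positive.\<close>
  then have tw: "t powi (n - m) = w" "t powi (m - n) = inverse w"
    using nz w by (auto simp: power_int_diff units_def field_simps)
  then have "n - m \<le> 0" "m - n \<le> 0"
    using w units_inverse[OF w] uniformizer_powi_unit_imp_nonpos by metis+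
  then show "m = n" by simp
qed

text \<open>Divide by \<open>t\<close> as often as possible; the last quotient is outside the
  maximal ideal, hence a unit.\<close>

lemma factorization:
  assumes f: "f \<in> C" "f \<noteq> 0"
  obtains n u where "f = t ^ n * u" "u \<in> units"
proof -
  \<comment> \<open>Otherwise the quotients generate an ascending chain of principal ideals. It
    becomes stationary, and there \<open>inverse t\<close> would lie in \<open>C\<close>.\<close>
  have "\<exists>n. f / t ^ n \<notin> C"
  proof (rule ccontr)
    assume "\<not> ?thesis"
    then have in_C: "f / t ^ n \<in> C" for n by blast
    define I where "I n = cgenideal (ring_on C) (f / t ^ n)" for n
    have I_ideal: "ideal (I n) (ring_on C)" for n
      unfolding I_def using in_C by (intro cgenideal_ideal) simp
    have "I n \<subseteq> I (Suc n)" for n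
      unfolding I_def
    proof (intro cgenideal_minimal)
      show "ideal (cgenideal (ring_on C) (f / t ^ Suc n)) (ring_on C)"
        using I_ideal[of "Suc n"] unfolding I_def .
      have "f / t ^ n = t * (f / t ^ Suc n)" using uniformizer_nonzero by simp
      then show "f / t ^ n \<in> cgenideal (ring_on C) (f / t ^ Suc n)"
        unfolding cgenideal_def ring_on_simps using uniformizer_in by blast
    qed
    then have I_mono: "I m \<subseteq> I n" if "m \<le> n" for m n using lift_Suc_mono_le[of I] that by blast
    have "I m \<subseteq> I n \<or> I n \<subseteq> I m" for m n using I_mono nat_le_linear by metis
    then have "subset.chain {K. ideal K (ring_on C)} (range I)"
      using I_ideal unfolding subset_chain_def by blast
    then have "\<Union>(range I) \<in> range I" by (intro ideal_chain_is_trivial) auto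
    then obtain n where "I (Suc n) \<subseteq> I n" by blast
    moreover have "f / t ^ Suc n \<in> I (Suc n)" 
      unfolding I_def using in_C[of "Suc n"] by (intro cgenideal_self) (simp del: power_Suc)
    ultimately obtain x where "x \<in> C" "f / t ^ Suc n = x * (f / t ^ n)" by (auto simp: I_def cgenideal_def)
    then have "inverse t = x" using f uniformizer_nonzero by (simp add: field_simps)
    then show False using \<open>x \<in> C\<close> inverse_uniformizer_notin by simp
  qed
  then obtain k where k: "f / t ^ k \<notin> C" ..
  have "\<exists>n. f / t ^ n \<in> C \<and> f / t ^ Suc n \<notin> C"
  proof (rule ccontr)
    assume "\<not> ?thesis"
    then have "f / t ^ n \<in> C" for n using f(1) by (induction n) (simp_all del: power_Suc)
    then show False using k by blast
  qed
  then obtain n where n: "f / t ^ n \<in> C" "f / t ^ Suc n \<notin> C" by blast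
  have "f / t ^ n \<notin> max_ideal C"
  proof
    assume "f / t ^ n \<in> max_ideal C"
    then obtain x where "x \<in> C" "f / t ^ n = x * t" using max_ideal_eq[OF uniformizer] by auto
    then have "f / t ^ Suc n = x" using uniformizer_nonzero by (simp add: field_simps)
    then show False using n(2) \<open>x \<in> C\<close> by simp
  qed
  then have "f / t ^ n \<in> units"
    using n(1) f inverse_in_if_notin_max_ideal[OF n(1)] uniformizer_nonzero by (simp add: units_def)
  then show thesis using that[of n "f / t ^ n"] uniformizer_nonzero by simp
qed

lemma ord_along_ge:
  assumes r: "r \<in> max_ideal C" and h: "h \<in> C" and nz: "r ^ N * h \<noteq> 0"
  shows "int N \<le> ord_along C (r ^ N * h)"
proof -
  obtain x where x: "x \<in> C" "r = x * t" using r max_ideal_eq[OF uniformizer] by auto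
  then have eq: "r ^ N * h = t ^ N * (x ^ N * h)" by (simp add: power_mult_distrib)
  have "x ^ N * h \<in> C" "x ^ N * h \<noteq> 0"
    using x h nz by (auto intro: closed power_closed simp: eq)
  then obtain n u where "x ^ N * h = t ^ n * u" and u: "u \<in> units" by (rule factorization)
  then have "r ^ N * h = t powi int (N + n) * u" by (simp add: eq power_add power_int_add uniformizer_nonzero)
  then show ?thesis using ord_along_eq[OF u, of "int (N + n)"] by simp
qed

end

section \<open>Elements of large order on a resolution\<close>

lemma discrete_valuation_ring_exists:
  assumes "regular_local_ring C" "krull_dim C = 1"
  obtains t where "discrete_valuation_ring C t"
proof -
  obtain S where S: "enat (card S) = krull_dim C" "max_ideal C = genideal (ring_on C) S"
    using assms(1) by (auto simp: regular_local_ring_def)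
  then have "card S = 1" using assms(2) by (simp add: one_enat_def)
  then obtain t where "S = {t}" by (rule card_1_singletonE)
  then show thesis using that[of t] S assms by (simp add: discrete_valuation_ring_def)
qed

lemma model_contains_base:
  assumes "proper_birational_model R X" "x \<in> X"
  shows "R \<subseteq> x"
proof -
  obtain \<A> A P where A: "fg_algebra R A" "primeideal P (ring_on A)" "x = localization A P"
    using assms unfolding proper_birational_model_def affine_cover_def spectrum_def by blast
  have "R \<subseteq> A"
    using A(1) by (auto simp: fg_algebra_def intro: generate_ring.incl)
  moreover have "A \<subseteq> x"
  proof -
    have id: "ideal P (ring_on A)" using A(2) by (rule primeideal.axioms(1))
    have "1 \<in> A" using A(1) generate_ring.one[of "ring_on UNIV"] by (force simp: fg_algebra_def)
    moreover have "1 \<notin> P"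
      using ideal.one_imp_carrier[OF id] primeideal.I_notcarr[OF A(2)] by auto
    ultimately show ?thesis unfolding A(3) localization_def by force
  qed
  ultimately show ?thesis by blast
qed

text \<open>Every element of the field is a fraction of elements of \<open>R\<close>, so the maximal
  ideal of each prime divisor contains a nonzero element of \<open>R\<close>. A product of
  \<open>N\<close>-th powers of such elements works, and will show that multiplier ideals are
  nonzero.\<close>

lemma ex_element_of_large_order:
  assumes R: "\<forall>f. \<exists>g\<in>R. \<exists>h\<in>R. h \<noteq> 0 \<and> f = g / h" and X: "resolution R X"
    and \<C>: "finite \<C>" "\<C> \<subseteq> prime_divisors X"
  obtains f where "f \<noteq> 0" "\<And>C. C \<in> prime_divisors X \<Longrightarrow> 0 \<le> ord_along C f"
    "\<And>C. C \<in> \<C> \<Longrightarrow> int N \<le> ord_along C f"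
proof -
  have dvr: "\<exists>t. discrete_valuation_ring C t" if "C \<in> prime_divisors X" for C
    using that X discrete_valuation_ring_exists[of C] by (auto simp: prime_divisors_def resolution_def)
  have R_sub: "R \<subseteq> C" if "C \<in> prime_divisors X" for C
    using that X model_contains_base by (auto simp: prime_divisors_def resolution_def)
  have "\<exists>g\<in>R. g \<noteq> 0 \<and> g \<in> max_ideal C" if C: "C \<in> prime_divisors X" for C
  proof -
    obtain t where "discrete_valuation_ring C t" using dvr[OF C] by blast
    then interpret discrete_valuation_ring C t .
    \<comment> \<open>Writing the uniformizer as a fraction over \<open>R\<close> makes its
      numerator a multiple of it in \<open>C\<close>.\<close>
    obtain g h where gh: "g \<in> R" "h \<in> R" "h \<noteq> 0" "t = g / h" using R by metis
    then have g: "g = h * t" by simp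
    have "h \<in> C" using gh(2) R_sub[OF C] by blast
    then have "g \<in> max_ideal C" unfolding max_ideal_eq[OF uniformizer] g by blast
    moreover have "g \<noteq> 0" using g gh(3) uniformizer_nonzero by simp
    ultimately show ?thesis using gh(1) by blast
  qed
  then obtain r where r: "\<And>C. C \<in> prime_divisors X \<Longrightarrow> r C \<in> R \<and> r C \<noteq> 0 \<and> r C \<in> max_ideal C"
    by metis
  define f where "f = (\<Prod>C\<in>\<C>. r C ^ N)"
  have nz: "f \<noteq> 0" using r \<C> by (auto simp: f_def)
  have prod_in: "(\<Prod>C'\<in>\<D>. r C' ^ N) \<in> C" if C: "C \<in> prime_divisors X" and \<D>: "\<D> \<subseteq> \<C>" for C \<D>
  proof -
    obtain t where "discrete_valuation_ring C t" using dvr[OF C] by blast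
    then interpret discrete_valuation_ring C t .
    have "finite \<D>" using \<D> \<C>(1) by (rule finite_subset)
    then show ?thesis using \<D>
    proof induction
      case (insert C' \<D>)
      then show ?case using r[of C'] \<C>(2) R_sub[OF C] by (auto intro!: closed(5) power_closed)
    qed (simp add: closed)
  qed
  show thesis
  proof
    show "f \<noteq> 0" by (rule nz)
  next
    fix C assume C: "C \<in> prime_divisors X"
    obtain t where "discrete_valuation_ring C t" using dvr[OF C] by blast
    then interpret discrete_valuation_ring C t .
    \<comment> \<open>The general bound with exponent 0, applied to \<open>f\<close> as an element
      of \<open>C\<close>.\<close>
    show "0 \<le> ord_along C f"
      using ord_along_ge[of "r C" f 0] r[OF C] nz prod_in[OF C, of \<C>] by (simp add: f_def)
  next
    fix C assume C: "C \<in> \<C>"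
    then have C': "C \<in> prime_divisors X" using \<C> by blast
    obtain t where "discrete_valuation_ring C t" using dvr[OF C'] by blast
    then interpret discrete_valuation_ring C t .
    have "f = r C ^ N * (\<Prod>C'\<in>\<C> - {C}. r C' ^ N)"
      unfolding f_def by (rule prod.remove[OF \<C>(1) C])
    then show "int N \<le> ord_along C f"
      using ord_along_ge[of "r C" "\<Prod>C'\<in>\<C> - {C}. r C' ^ N" N] r[OF C'] nz prod_in[OF C', of "\<C> - {C}"]
      by auto
  qed
qed

section \<open>Mixed multiplier ideals\<close>

text \<open>Membership in a multiplier ideal bounds the order along each divisor from below, so
  \<open>J \<xi> \<subseteq> J x\<close> need only be tested on elements of \<open>J \<xi>\<close>
  of least order along each divisor in the support of some \<open>F i\<close>. Elsewhere the
  condition does not depend on the point.\<close>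

lemma mixed_multiplier_ideal_open_regions:
  fixes F :: "'r::finite \<Rightarrow> 'k::field set \<Rightarrow> int" and K :: "'k set \<Rightarrow> rat"
  assumes R: "\<forall>f. \<exists>g\<in>R. \<exists>h\<in>R. h \<noteq> 0 \<and> f = g / h" and X: "resolution R X"
    and F: "\<And>i. is_divisor X (F i)" "\<And>i C. 0 \<le> F i C"
    and K: "finite (exceptional_divisors R X)" "\<And>C. C \<notin> exceptional_divisors R X \<Longrightarrow> K C = 0"
  shows "\<exists>c. open_regions (mixed_multiplier_ideal X K F) {C. \<exists>i. F i C \<noteq> 0}
    (\<lambda>C. \<chi> i. of_int (F i C)) c"
proof -
  define J where "J = mixed_multiplier_ideal X K F"
  define S where "S = {C. \<exists>i. F i C \<noteq> 0}"
  define l :: "'k set \<Rightarrow> real ^ 'r" where "l C = (\<chi> i. of_int (F i C))" for C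
  define d where "d x C = \<lceil>of_rat (K C) - l C \<bullet> x\<rceil>" for x C
  have J_eq: "J x = sections_of X (d x)" for x
    unfolding J_def mixed_multiplier_ideal_def d_def[abs_def] l_def inner_vec_def
    by (simp add: mult.commute)
  have J_iff: "f \<in> J x \<longleftrightarrow> f = 0 \<or> (\<forall>C\<in>prime_divisors X. 0 \<le> ord_along C f + d x C)" for f x
    by (simp add: J_eq sections_of_def)
  have "S = (\<Union>i. {C. F i C \<noteq> 0})" by (auto simp: S_def)
  then have S: "finite S" "S \<subseteq> prime_divisors X" using F(1) by (auto simp: is_divisor_def)
  have l_zero: "l C = 0" if "C \<notin> S" for C using that by (simp add: S_def l_def vec_eq_iff)
  have l_orthant: "l C \<in> orthant" for C using F(2) by (simp add: l_def orthant_def)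
  have nonzero: "\<exists>f. f \<in> J x \<and> f \<noteq> 0" for x
  proof -
    let ?C = "S \<union> exceptional_divisors R X"
    \<comment> \<open>The sum of the positive parts of the required orders bounds each of
      them.\<close>
    define N where "N = (\<Sum>C\<in>?C. nat (- d x C))"
    have fin: "finite ?C" using S K by simp
    have "?C \<subseteq> prime_divisors X" using S by (auto simp: exceptional_divisors_def)
    from ex_element_of_large_order[OF R X fin this, of N] obtain f where f: "f \<noteq> 0"
      "\<And>C. C \<in> prime_divisors X \<Longrightarrow> 0 \<le> ord_along C f" "\<And>C. C \<in> ?C \<Longrightarrow> int N \<le> ord_along C f"
      by blast
    have "0 \<le> ord_along C f + d x C" if C: "C \<in> prime_divisors X" for C
    proof (cases "C \<in> ?C")
      case True
      then have "nat (- d x C) \<le> N" unfolding N_def using fin by (intro member_le_sum) auto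
      then show ?thesis using f(3)[OF True] by linarith
    next
      case False
      then have "d x C = 0" using K(2)[of C] l_zero[of C] by (simp add: d_def)
      then show ?thesis using f(2)[OF C] by simp
    qed
    then show ?thesis using f(1) by (auto simp: J_iff)
  qed
  have "\<exists>g. (g \<in> J x \<and> g \<noteq> 0) \<and> (\<forall>f. f \<in> J x \<and> f \<noteq> 0 \<longrightarrow> ord_along C g \<le> ord_along C f)"
    if C: "C \<in> S" for x C
  proof -
    obtain f0 where "f0 \<in> J x \<and> f0 \<noteq> 0" using nonzero by blast
    \<comment> \<open>Orders on \<open>J x\<close> are at least \<open>- d x C\<close>, so after
      this shift they are natural numbers and a least one exists.\<close>
    from ex_has_least_nat[of "\<lambda>f. f \<in> J x \<and> f \<noteq> 0", OF this, of "\<lambda>f. nat (ord_along C f + d x C)"]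
    obtain g where g: "g \<in> J x \<and> g \<noteq> 0"
      "\<forall>f. f \<in> J x \<and> f \<noteq> 0 \<longrightarrow> nat (ord_along C g + d x C) \<le> nat (ord_along C f + d x C)"
      by blast
    have "0 \<le> ord_along C f + d x C" if "f \<in> J x \<and> f \<noteq> 0" for f
      using that C S by (auto simp: J_iff)
    then show ?thesis using g by (intro exI[of _ g]) (auto simp: nat_le_eq_zle)
  qed
  note least = someI_ex[OF this]
  define g where "g x C = (SOME g. (g \<in> J x \<and> g \<noteq> 0) \<and>
      (\<forall>f. f \<in> J x \<and> f \<noteq> 0 \<longrightarrow> ord_along C g \<le> ord_along C f))" for x C
  have g: "\<And>x C. C \<in> S \<Longrightarrow> g x C \<in> J x \<and> g x C \<noteq> 0"
    "\<And>x C f. C \<in> S \<Longrightarrow> f \<in> J x \<Longrightarrow> f \<noteq> 0 \<Longrightarrow> ord_along C (g x C) \<le> ord_along C f"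
    using least unfolding g_def by blast+
  \<comment> \<open>The ceiling in \<open>d\<close> turns the integral condition into a strict real
    inequality with threshold one higher; this is why the half-spaces are open.\<close>
  define c where "c x C = of_rat (K C) + 1 + real_of_int (ord_along C (g x C))" for x C
  have d_iff: "0 \<le> n + d x C \<longleftrightarrow> l C \<bullet> x < of_rat (K C) + 1 + real_of_int n" for n x C
    unfolding d_def by linarith
  have region_eq: "region J \<xi> = {x \<in> orthant. \<forall>C\<in>S. l C \<bullet> x < c \<xi> C}" for \<xi>
  proof -
    have "J \<xi> \<subseteq> J x \<longleftrightarrow> (\<forall>C\<in>S. l C \<bullet> x < c \<xi> C)" for x
    proof
      assume sub: "J \<xi> \<subseteq> J x"
      show "\<forall>C\<in>S. l C \<bullet> x < c \<xi> C"
      proof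
        fix C assume C: "C \<in> S"
        then have "0 \<le> ord_along C (g \<xi> C) + d x C"
          using g(1)[OF C, of \<xi>] sub S(2) by (auto simp: J_iff subset_iff)
        then show "l C \<bullet> x < c \<xi> C" by (simp add: d_iff c_def)
      qed
    next
      assume less: "\<forall>C\<in>S. l C \<bullet> x < c \<xi> C"
      show "J \<xi> \<subseteq> J x"
      proof
        fix f assume f: "f \<in> J \<xi>"
        have "0 \<le> ord_along C f + d x C" if C: "C \<in> prime_divisors X" and "f \<noteq> 0" for C
        proof (cases "C \<in> S")
          case True
          then have "l C \<bullet> x < c \<xi> C" using less by blast
          also have "\<dots> \<le> of_rat (K C) + 1 + real_of_int (ord_along C f)"
            using g(2)[OF True f \<open>f \<noteq> 0\<close>] by (simp add: c_def)
          finally show ?thesis by (simp add: d_iff)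
        next
          case False
          then have "d x C = d \<xi> C" by (simp add: d_def l_zero)
          then show ?thesis using f C \<open>f \<noteq> 0\<close> by (auto simp: J_iff)
        qed
        then show "f \<in> J x" by (auto simp: J_iff)
      qed
    qed
    then show ?thesis by (auto simp: region_def)
  qed
  have "open_regions J S l c"
  proof
    show "finite S" by (rule S(1))
    show "l C \<in> orthant" for C by (rule l_orthant)
    show "l C \<noteq> 0" if "C \<in> S" for C using that by (auto simp: S_def l_def vec_eq_iff)
    show "region J \<xi> = {x \<in> orthant. \<forall>C\<in>S. l C \<bullet> x < c \<xi> C}" for \<xi> by (rule region_eq)
    show "finite (J ` region J \<xi>)" for \<xi>
    proof -
      \<comment> \<open>The ideal depends only on the integer coefficients along \<open>S\<close>;
        since \<open>l C \<bullet> x\<close> lies between 0 and \<open>c \<xi> C\<close> on the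
        region, these range over a finite box.\<close>
      let ?P = "PiE S (\<lambda>C. {\<lceil>of_rat (K C) - c \<xi> C\<rceil>..\<lceil>of_rat (K C) :: real\<rceil>})"
      let ?s = "\<lambda>h. sections_of X (\<lambda>C. if C \<in> S then h C else \<lceil>of_rat (K C) :: real\<rceil>)"
      have "J x \<in> ?s ` ?P" if "x \<in> region J \<xi>" for x
      proof
        have x: "x \<in> orthant" "\<forall>C\<in>S. l C \<bullet> x < c \<xi> C" using that region_eq by auto
        have "0 \<le> l C \<bullet> x" for C using l_orthant x(1) by (rule in_orthant_inner_nonneg)
        then have "\<lceil>of_rat (K C) - c \<xi> C\<rceil> \<le> d x C \<and> d x C \<le> \<lceil>of_rat (K C) :: real\<rceil>" if "C \<in> S" for C
          using x(2) that unfolding d_def by (intro conjI ceiling_mono) (auto simp: less_imp_le)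
        then show "restrict (d x) S \<in> ?P" by (simp add: PiE_iff del: of_rat_ceiling)
        have "d x = (\<lambda>C. if C \<in> S then restrict (d x) S C else \<lceil>of_rat (K C) :: real\<rceil>)"
          by (auto simp: d_def l_zero)
        then show "J x = ?s (restrict (d x) S)" unfolding J_eq by (rule arg_cong)
      qed
      moreover have "finite ?P" using S(1) by (intro finite_PiE) auto
      ultimately show ?thesis by (meson finite_imageI finite_subset image_subsetI)
    qed
  qed
  then show ?thesis unfolding J_def S_def l_def by blast
qed

theorem proposition3p18:
  fixes \<iota> :: "complex \<Rightarrow> 'k::field" and R :: "'k set"
    and \<aa> :: "'r::finite \<Rightarrow> 'k set" and X' :: "'k set set"
    and F :: "'r \<Rightarrow> 'k set \<Rightarrow> int" and K :: "'k set \<Rightarrow> rat"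
    and \<Lambda> :: "real ^ 'r" and \<sigma> :: "nat \<Rightarrow> 'r algorithm_state"
  assumes "normal_surface_point \<iota> R"
    and "rational_singularity R"
    and "\<forall>i. ideal (\<aa> i) (ring_on R) \<and> \<aa> i \<noteq> {0}"
    and "log_resolution \<iota> R \<aa> X' F"
    and "relative_canonical_divisor R X' K"
    and "\<Lambda> \<in> orthant"
    and "algorithm_run (mixed_multiplier_ideal X' K F) \<sigma>"
  shows "\<exists>n. \<forall>\<mu> \<in> {0 + v |v. v \<in> orthant} \<inter> {\<Lambda> - v |v. v \<in> orthant}.
           \<exists>\<delta> \<in> set (snd (\<sigma> n)). \<delta> \<in> constancy_region (mixed_multiplier_ideal X' K F) \<mu>"
proof -
  have "\<forall>f. \<exists>g\<in>R. \<exists>h\<in>R. h \<noteq> 0 \<and> f = g / h"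
    using assms(1) by (simp add: normal_surface_point_def)
  moreover have "resolution R X'" "\<And>i. is_divisor X' (F i)" "\<And>i C. 0 \<le> F i C"
    "finite (exceptional_divisors R X')"
    using assms(4) by (simp_all add: log_resolution_def tree_of_curves_def)
  moreover have "\<And>C. C \<notin> exceptional_divisors R X' \<Longrightarrow> K C = 0"
    using assms(5) by (simp add: relative_canonical_divisor_def)
  ultimately obtain c where "open_regions (mixed_multiplier_ideal X' K F) {C. \<exists>i. F i C \<noteq> 0}
      (\<lambda>C. \<chi> i. of_int (F i C)) c"
    using mixed_multiplier_ideal_open_regions[of R X' F K] by blast
  then interpret open_regions "mixed_multiplier_ideal X' K F" "{C. \<exists>i. F i C \<noteq> 0}"
    "\<lambda>C. \<chi> i. of_int (F i C)" c .
  obtain n where n: "\<And>\<mu>. \<mu> \<in> orthant \<Longrightarrow> \<Lambda> - \<mu> \<in> orthant \<Longrightarrow>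
      \<exists>\<delta>\<in>set (snd (\<sigma> n)). \<delta> \<in> constancy_region (mixed_multiplier_ideal X' K F) \<mu>"
    using run_represents_box[OF assms(7,6)] by blast
  show ?thesis
    by (intro exI[of _ n] ballI n) auto
qed

end
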